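(* The monoids $\mathcal{M}$ and $\overline{\mathcal{M}}$ are wild refinement monoids. They are conical, stably finite, antisymmetric, separative, and unperforated. The monoid $\mathcal{M}$ is archimedean, but $\overline{\mathcal{M}}$ is not. There are o-ideals $J_1\subset J_2$ in $\mathcal{M}$ such that $$J_1\cong(\mathbb{Z}^+)^{(\mathbb{N})},\qquad J_2/J_1\cong(\mathbb{Z}^+)^2,\qquad \mathcal{M}/J_2\cong\mathbb{Z}^+.$$ Moreover, $\overline{\mathcal{M}}\cong\mathcal{M}/J_1$, and $\overline{\mathcal{M}}$ has an o-ideal $\overline{J}_2$ such that $\overline{J}_2\cong(\mathbb{Z}^+)^2$ and $\overline{\mathcal{M}}/\overline{J}_2\cong\mathbb{Z}^+$.
   Context: All monoids are commutative, written additively. $\mathbb{Z}^+$ is the additive monoid of nonnegative integers, $\mathbb{N}$ the positive integers, and $(\mathbb{Z}^+)^{(\mathbb{N})}$ the direct sum of countably many copies of $\mathbb{Z}^+$. $\mathcal{M}$ is the commutative monoid presented by generators $x_0,y_0,z_0,a_1,x_1,y_1,z_1,a_2,x_2,y_2,z_2,\dots$ and relations $x_0+y_0=x_0+z_0$ and, for all $l\ge0$, $y_l=y_{l+1}+a_{l+1}$, $z_l=z_{l+1}+a_{l+1}$, $x_l=x_{l+1}+y_{l+1}=x_{l+1}+z_{l+1}$. $\overline{\mathcal{M}}$ is the commutative monoid presented by generators $\overline{x}_0,\overline{y}_0,\overline{z}_0,\overline{x}_1,\overline{x}_2,\dots$ and relations $\overline{x}_0+\overline{y}_0=\overline{x}_0+\overline{z}_0$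 and, for all $l\ge0$, $\overline{x}_l=\overline{x}_{l+1}+\overline{y}_0=\overline{x}_{l+1}+\overline{z}_0$. For a monoid $M$: the algebraic ordering is $x\le y$ iff $x+z=y$ for some $z\in M$. $M$ is a refinement monoid if whenever $x_1+x_2=y_1+y_2$ in $M$, there exist $z_{ij}\in M$ with $x_i=z_{i1}+z_{i2}$ and $y_j=z_{1j}+z_{2j}$ for $i,j=1,2$. A refinement monoid is tame if it is an inductive (directed) limit, in the category of commutative monoids, of an inductive system of finitely generated refinement monoids, and wild otherwise. $M$ is conical if $x+y=0$ implies $x=y=0$; stably finite if $x+y=x$ implies $y=0$; antisymmetric if the algebraic ordering is antisymmetric; separative if $2x=2y=x+y$ implies $x=y$; unperforated if $mx\le my$ implies $x\le y$ for all $m\in\mathbb{N}$; archimedean if $x,y\in M$ satisfy $nx\le y$ for all $n\in\mathbb{N}$ only when $x$ is invertible. An o-ideal of $M$ is a submonoid $J$ such that $x\le y\in J$ implies $x\in J$. For an o-ideal $J$, $M/J$ is the quotient of $M$ by the congruence $x\equiv_J y$ iff $x+a=y+b$ for some $a,b\in J$. *)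

theory Defs
  imports "HOL-Algebra.Divisibility" "HOL-Library.Poly_Mapping"
begin

text \<open>
  Commutative monoids are those of \<^theory>\<open>HOL-Algebra.Group\<close>, hence written multiplicatively:
  \<open>x + y\<close> is \<open>x \<otimes> y\<close>, \<open>0\<close> is \<open>\<one>\<close>, \<open>n x\<close> is \<open>x [^] n\<close>, and the algebraic ordering \<open>x \<le> y\<close> is
  \<open>x divides y\<close>. A submonoid \<open>J\<close> of \<open>M\<close> is regarded as a monoid via \<open>M\<lparr>carrier := J\<rparr>\<close>.
\<close>

subsection \<open>Properties of commutative monoids\<close>

definition refinement_monoid :: "'a monoid \<Rightarrow> bool" where
  "refinement_monoid M \<longleftrightarrow> comm_monoid M \<and>
     (\<forall>x1\<in>carrier M. \<forall>x2\<in>carrier M. \<forall>y1\<in>carrier M. \<forall>y2\<in>carrier M.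
        x1 \<otimes>\<^bsub>M\<^esub> x2 = y1 \<otimes>\<^bsub>M\<^esub> y2 \<longrightarrow>
        (\<exists>z11\<in>carrier M. \<exists>z12\<in>carrier M. \<exists>z21\<in>carrier M. \<exists>z22\<in>carrier M.
           x1 = z11 \<otimes>\<^bsub>M\<^esub> z12 \<and> x2 = z21 \<otimes>\<^bsub>M\<^esub> z22 \<and>
           y1 = z11 \<otimes>\<^bsub>M\<^esub> z21 \<and> y2 = z12 \<otimes>\<^bsub>M\<^esub> z22))"

definition conical :: "'a monoid \<Rightarrow> bool" where
  "conical M \<longleftrightarrow> (\<forall>x\<in>carrier M. \<forall>y\<in>carrier M. x \<otimes>\<^bsub>M\<^esub> y = \<one>\<^bsub>M\<^esub> \<longrightarrow> x = \<one>\<^bsub>M\<^esub> \<and> y = \<one>\<^bsub>M\<^esub>)"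

definition stably_finite :: "'a monoid \<Rightarrow> bool" where
  "stably_finite M \<longleftrightarrow> (\<forall>x\<in>carrier M. \<forall>y\<in>carrier M. x \<otimes>\<^bsub>M\<^esub> y = x \<longrightarrow> y = \<one>\<^bsub>M\<^esub>)"

definition antisymmetric :: "'a monoid \<Rightarrow> bool" where
  "antisymmetric M \<longleftrightarrow>
     (\<forall>x\<in>carrier M. \<forall>y\<in>carrier M. x divides\<^bsub>M\<^esub> y \<and> y divides\<^bsub>M\<^esub> x \<longrightarrow> x = y)"

definition separative :: "'a monoid \<Rightarrow> bool" where
  "separative M \<longleftrightarrow>
     (\<forall>x\<in>carrier M. \<forall>y\<in>carrier M.
        x \<otimes>\<^bsub>M\<^esub> x = y \<otimes>\<^bsub>M\<^esub> y \<and> y \<otimes>\<^bsub>M\<^esub> y = x \<otimes>\<^bsub>M\<^esub> y \<longrightarrow> x = y)"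

definition unperforated :: "'a monoid \<Rightarrow> bool" where
  "unperforated M \<longleftrightarrow>
     (\<forall>m::nat. m \<ge> 1 \<longrightarrow> (\<forall>x\<in>carrier M. \<forall>y\<in>carrier M.
        (x [^]\<^bsub>M\<^esub> m) divides\<^bsub>M\<^esub> (y [^]\<^bsub>M\<^esub> m) \<longrightarrow> x divides\<^bsub>M\<^esub> y))"

definition archimedean :: "'a monoid \<Rightarrow> bool" where
  "archimedean M \<longleftrightarrow>
     (\<forall>x\<in>carrier M. \<forall>y\<in>carrier M.
        (\<forall>n::nat. n \<ge> 1 \<longrightarrow> (x [^]\<^bsub>M\<^esub> n) divides\<^bsub>M\<^esub> y) \<longrightarrow> x \<in> Units M)"

definition finitely_generated :: "'a monoid \<Rightarrow> bool" where
  "finitely_generated M \<longleftrightarrow>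
     (\<exists>S. finite S \<and> S \<subseteq> carrier M \<and> (\<forall>N. submonoid N M \<and> S \<subseteq> N \<longrightarrow> N = carrier M))"

definition o_ideal :: "'a set \<Rightarrow> 'a monoid \<Rightarrow> bool" where
  "o_ideal J M \<longleftrightarrow> submonoid J M \<and> (\<forall>x\<in>carrier M. \<forall>y\<in>J. x divides\<^bsub>M\<^esub> y \<longrightarrow> x \<in> J)"


subsection \<open>Quotients and presentations\<close>

text \<open>Meaningful when \<open>r\<close> is a congruence on \<open>M\<close>; the product of two classes is then one class.\<close>

definition quotient_monoid :: "'a monoid \<Rightarrow> ('a \<times> 'a) set \<Rightarrow> 'a set monoid" where
  "quotient_monoid M r =
     \<lparr>carrier = carrier M // r,
      mult = (\<lambda>A B. \<Union>x\<in>A. \<Union>y\<in>B. r `` {x \<otimes>\<^bsub>M\<^esub> y}),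
      one = r `` {\<one>\<^bsub>M\<^esub>}\<rparr>"

definition o_ideal_cong :: "'a monoid \<Rightarrow> 'a set \<Rightarrow> ('a \<times> 'a) set" where
  "o_ideal_cong M J =
     {(x, y). x \<in> carrier M \<and> y \<in> carrier M \<and> (\<exists>a\<in>J. \<exists>b\<in>J. x \<otimes>\<^bsub>M\<^esub> a = y \<otimes>\<^bsub>M\<^esub> b)}"

definition o_ideal_quotient :: "'a monoid \<Rightarrow> 'a set \<Rightarrow> 'a set monoid" (infixl \<open>'/'/\<^sub>o\<close> 75) where
  "M //\<^sub>o J = quotient_monoid M (o_ideal_cong M J)"

definition additive_monoid :: "'a::comm_monoid_add monoid" where
  "additive_monoid = \<lparr>carrier = UNIV, mult = (+), one = 0\<rparr>"

inductive_set generated_cong :: "('g multiset \<times> 'g multiset) set \<Rightarrow> ('g multiset \<times> 'g multiset) set"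
  for R where
  base: "(u, v) \<in> R \<Longrightarrow> (u, v) \<in> generated_cong R"
| refl: "(u, u) \<in> generated_cong R"
| sym: "(u, v) \<in> generated_cong R \<Longrightarrow> (v, u) \<in> generated_cong R"
| trans: "(u, v) \<in> generated_cong R \<Longrightarrow> (v, w) \<in> generated_cong R \<Longrightarrow> (u, w) \<in> generated_cong R"
| add: "(u, v) \<in> generated_cong R \<Longrightarrow> (u + w, v + w) \<in> generated_cong R"

text \<open>The free commutative monoid on the set of all elements of \<open>'g\<close> is \<open>'g multiset\<close>.\<close>

definition presented_monoid :: "('g multiset \<times> 'g multiset) set \<Rightarrow> 'g multiset set monoid" where
  "presented_monoid R = quotient_monoid additive_monoid (generated_cong R)"


subsection \<open>Inductive limits and tameness\<close>

text \<open>\<open>(i, j) \<in> r\<close> means \<open>i \<le> j\<close>, and \<open>\<phi> i j\<close> is the transition map from \<open>G i\<close> to \<open>G j\<close>.\<close>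

definition inductive_system ::
    "'i set \<Rightarrow> ('i \<times> 'i) set \<Rightarrow> ('i \<Rightarrow> 'b monoid) \<Rightarrow> ('i \<Rightarrow> 'i \<Rightarrow> 'b \<Rightarrow> 'b) \<Rightarrow> bool" where
  "inductive_system I r G \<phi> \<longleftrightarrow>
     I \<noteq> {} \<and> preorder_on I r \<and> (\<forall>i\<in>I. \<forall>j\<in>I. \<exists>k\<in>I. (i, k) \<in> r \<and> (j, k) \<in> r) \<and>
     (\<forall>i\<in>I. comm_monoid (G i)) \<and>
     (\<forall>i j. (i, j) \<in> r \<longrightarrow> \<phi> i j \<in> hom (G i) (G j) \<and> \<phi> i j \<one>\<^bsub>G i\<^esub> = \<one>\<^bsub>G j\<^esub>) \<and>
     (\<forall>i\<in>I. \<forall>x\<in>carrier (G i). \<phi> i i x = x) \<and>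
     (\<forall>i j k. (i, j) \<in> r \<and> (j, k) \<in> r \<longrightarrow> (\<forall>x\<in>carrier (G i). \<phi> j k (\<phi> i j x) = \<phi> i k x))"

text \<open>
  The inductive limit is the usual quotient of the disjoint union of the \<open>G i\<close>: elements are
  identified when they become equal at some later stage.
\<close>

definition limit_rel ::
    "'i set \<Rightarrow> ('i \<times> 'i) set \<Rightarrow> ('i \<Rightarrow> 'b monoid) \<Rightarrow> ('i \<Rightarrow> 'i \<Rightarrow> 'b \<Rightarrow> 'b) \<Rightarrow>
     (('i \<times> 'b) \<times> ('i \<times> 'b)) set" where
  "limit_rel I r G \<phi> =
     {((i, x), (j, y)). i \<in> I \<and> j \<in> I \<and> x \<in> carrier (G i) \<and> y \<in> carrier (G j) \<and>
        (\<exists>k. (i, k) \<in> r \<and> (j, k) \<in> r \<and> \<phi> i k x = \<phi> j k y)}"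

definition inductive_limit ::
    "'i set \<Rightarrow> ('i \<times> 'i) set \<Rightarrow> ('i \<Rightarrow> 'b monoid) \<Rightarrow> ('i \<Rightarrow> 'i \<Rightarrow> 'b \<Rightarrow> 'b) \<Rightarrow>
     ('i \<times> 'b) set monoid" where
  "inductive_limit I r G \<phi> =
     \<lparr>carrier = (SIGMA i:I. carrier (G i)) // limit_rel I r G \<phi>,
      mult = (\<lambda>A B. \<Union>(i, x)\<in>A. \<Union>(j, y)\<in>B. \<Union>k\<in>{k. (i, k) \<in> r \<and> (j, k) \<in> r}.
                limit_rel I r G \<phi> `` {(k, \<phi> i k x \<otimes>\<^bsub>G k\<^esub> \<phi> j k y)}),
      one = (\<Union>i\<in>I. limit_rel I r G \<phi> `` {(i, \<one>\<^bsub>G i\<^esub>)})\<rparr>"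

text \<open>
  HOL cannot quantify over types inside a formula, so the type \<open>'i\<close> of indices and the common
  ambient type \<open>'b\<close> of the monoids in the system are parameters. A theorem asserting wildness
  with \<open>'i\<close> and \<open>'b\<close> left as type variables excludes inductive systems over all types.
\<close>

definition tame :: "'i itself \<Rightarrow> 'b itself \<Rightarrow> 'a monoid \<Rightarrow> bool" where
  "tame _ _ M \<longleftrightarrow> refinement_monoid M \<and>
     (\<exists>(I :: 'i set) r (G :: 'i \<Rightarrow> 'b monoid) \<phi>.
        inductive_system I r G \<phi> \<and>
        (\<forall>i\<in>I. refinement_monoid (G i) \<and> finitely_generated (G i)) \<and>
        M \<cong> inductive_limit I r G \<phi>)"

definition wild :: "'i itself \<Rightarrow> 'b itself \<Rightarrow> 'a monoid \<Rightarrow> bool" where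
  "wild ti tb M \<longleftrightarrow> refinement_monoid M \<and> \<not> tame ti tb M"


subsection \<open>The monoids\<close>

text \<open>The generators \<open>a\<^sub>1, a\<^sub>2, \<dots>\<close> start at index 1: \<open>GA l\<close> stands for \<open>a\<^bsub>l+1\<^esub>\<close>.\<close>

datatype gen = GX nat | GY nat | GZ nat | GA nat

definition rels :: "(gen multiset \<times> gen multiset) set" where
  "rels = {({#GX 0, GY 0#}, {#GX 0, GZ 0#})} \<union>
     (\<Union>l. {({#GY l#}, {#GY (Suc l), GA l#}),
            ({#GZ l#}, {#GZ (Suc l), GA l#}),
            ({#GX l#}, {#GX (Suc l), GY (Suc l)#}),
            ({#GX l#}, {#GX (Suc l), GZ (Suc l)#})})"

definition MM :: "gen multiset set monoid" where
  "MM = presented_monoid rels"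

datatype gen_bar = BX nat | BY | BZ

definition rels_bar :: "(gen_bar multiset \<times> gen_bar multiset) set" where
  "rels_bar = {({#BX 0, BY#}, {#BX 0, BZ#})} \<union>
     (\<Union>l. {({#BX l#}, {#BX (Suc l), BY#}),
            ({#BX l#}, {#BX (Suc l), BZ#})})"

definition MM_bar :: "gen_bar multiset set monoid" where
  "MM_bar = presented_monoid rels_bar"

abbreviation Zplus :: "nat monoid" where
  "Zplus \<equiv> additive_monoid"

text \<open>Finitely supported functions; the countable index set of positive integers is replaced by
  \<^typ>\<open>nat\<close>.\<close>

abbreviation Zplus_sum :: "(nat \<Rightarrow>\<^sub>0 nat) monoid" where
  "Zplus_sum \<equiv> additive_monoid"

end

theory Submission
  imports Defs Complex_Main "HOL-Algebra.FiniteProduct" "HOL-Library.Function_Algebras"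
    "HOL-Library.Product_Plus"
begin

text \<open>
  Wildness rests on a failure of cancellation: \<open>x\<^sub>0 + y\<^sub>0 = x\<^sub>0 + z\<^sub>0\<close> but \<open>y\<^sub>0 \<noteq> z\<^sub>0\<close>, whereas a conical
  stably finite tame monoid is cancellative (\<open>tame_imp_cancellative\<close>). For the latter, start from
  \<open>x + y = x + z\<close> in a finitely generated refinement monoid and refine again and again. Dickson's
  lemma forces two of the elements so produced to be comparable, and this gives \<open>y = d + u\<close> and
  \<open>z = d + v\<close> where \<open>x\<close> absorbs some element above \<open>u\<close> and some element above \<open>v\<close>. This weak form of
  cancellation passes to inductive limits. If the limit is stably finite and conical, absorbed
  elements vanish, so \<open>u = v = 0\<close> and \<open>y = z\<close>.

  The remaining claims are read off from concrete models. In the quotient monoid, \<open>y\<close> and \<open>z\<close> become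
  indistinguishable as soon as one \<open>x\<close> is present, and \<open>x\<^sub>l\<close> behaves like \<open>x\<^sub>0 - l y\<close>. Hence an element
  is either \<open>i y + j z\<close> or is given by the number of its \<open>x\<close>s, at least one, together with an integer
  multiple of \<open>y\<close>. An element of the other monoid is a pair of such an \<open>m\<close> and a function
  \<open>g : \<nat> \<rightarrow> \<nat>\<close> which eventually agrees with an affine function determined by \<open>m\<close>: its slope is the
  number of \<open>x\<close>s. Here \<open>x\<^sub>l\<close> becomes \<open>k \<mapsto> max (k - l) 0\<close>, both \<open>y\<^sub>l\<close> and \<open>z\<^sub>l\<close> become the indicator of
  \<open>{l, l + 1, \<dots>}\<close>, and \<open>a\<^bsub>l+1\<^esub>\<close> the indicator of \<open>{l}\<close>; the defining relations are then identities between
  functions. That nothing more is identified follows from normal forms that depend on a stage \<open>n\<close> and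
  use the generators \<open>x\<^sub>n, y\<^sub>n, z\<^sub>n\<close> and \<open>a\<^sub>1, \<dots>, a\<^sub>n\<close> only (\<open>presented_monoid_iso\<close>).

  In the models the order is the evident one, and refinement for pairs \<open>(g, m)\<close> reduces to refinement
  for \<open>m\<close>, which prescribes the splitting of \<open>g\<close> at all large arguments, and to refinement in \<open>\<nat>\<close> at
  the others. The ideal \<open>J\<^sub>1\<close> consists of the pairs with \<open>m = 0\<close>, that is, \<open>g\<close> of finite support, and
  \<open>J\<^sub>2\<close> of those without \<open>x\<close>s, where \<open>g\<close> is eventually constant. The function \<open>g\<close> makes the monoid
  archimedean: \<open>n g \<le> h\<close> for all \<open>n\<close> forces \<open>g = 0\<close>. In the quotient \<open>g\<close> is lost, and \<open>n y \<le> x\<^sub>0\<close> for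
  all \<open>n\<close>.
\<close>

section \<open>Finitely generated refinement monoids\<close>

lemma dickson_subsequence:
  fixes f :: "nat \<Rightarrow> 'a \<Rightarrow> nat"
  assumes "finite S"
  shows "\<exists>r::nat \<Rightarrow> nat. strict_mono r \<and> (\<forall>s\<in>S. mono (\<lambda>n. f (r n) s))"
  using assms
proof induction
  case empty
  show ?case by (intro exI[of _ id]) (auto simp: strict_mono_def)
next
  case (insert a S)
  then obtain r :: "nat \<Rightarrow> nat" where r: "strict_mono r" "\<forall>s\<in>S. mono (\<lambda>n. f (r n) s)" by blast
  obtain q :: "nat \<Rightarrow> nat" where q: "strict_mono q" "monoseq (\<lambda>n. f (r (q n)) a)"
    using seq_monosub[of "\<lambda>n. f (r n) a"] by auto
  \<comment> \<open>A decreasing sequence of naturals attains its minimum and is constant from there on.\<close>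
  obtain k where k: "mono (\<lambda>n. f (r (q (k + n))) a)"
  proof (cases "\<forall>m n. m \<le> n \<longrightarrow> f (r (q m)) a \<le> f (r (q n)) a")
    case True
    then show ?thesis using that[of 0] by (auto simp: mono_def)
  next
    case False
    with q(2) have dec: "\<And>m n. m \<le> n \<Longrightarrow> f (r (q n)) a \<le> f (r (q m)) a"
      unfolding monoseq_def by blast
    obtain k where "\<And>n. f (r (q k)) a \<le> f (r (q n)) a"
      using ex_has_least_nat[of "\<lambda>_. True" _ "\<lambda>n. f (r (q n)) a"] by auto
    then have "f (r (q (k + n))) a = f (r (q k)) a" for n
      using dec[of k "k + n"] by (simp add: le_antisym)
    then show ?thesis using that[of k] by (simp add: mono_def)
  qed
  have "strict_mono (\<lambda>n. r (q (k + n)))"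
    using r(1) q(1) by (simp add: strict_mono_def)
  moreover have "mono (\<lambda>n. f (r (q (k + n))) s)" if "s \<in> S" for s
    using r(2) that strict_mono_mono[OF q(1)] by (auto simp: mono_def)
  ultimately show ?case using k by (intro exI[of _ "\<lambda>n. r (q (k + n))"]) auto
qed

lemma (in comm_monoid) submonoid_of_power_products:
  assumes "finite S" "S \<subseteq> carrier G"
  shows "submonoid {finprod G (\<lambda>s. s [^] f s) S | f :: 'a \<Rightarrow> nat. True} G" (is "submonoid ?N G")
    and "S \<subseteq> {finprod G (\<lambda>s. s [^] f s) S | f :: 'a \<Rightarrow> nat. True}"
proof -
  have cl: "(\<lambda>s. s [^] f s) \<in> S \<rightarrow> carrier G" for f :: "'a \<Rightarrow> nat"
    using assms(2) by auto
  show "submonoid ?N G"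
  proof
    show "?N \<subseteq> carrier G" using finprod_closed[OF cl] by auto
    show "\<one> \<in> ?N" by (auto intro!: exI[of _ "\<lambda>_. 0"])
    fix x y assume "x \<in> ?N" "y \<in> ?N"
    then obtain f g :: "'a \<Rightarrow> nat" where fg: "x = finprod G (\<lambda>s. s [^] f s) S"
      "y = finprod G (\<lambda>s. s [^] g s) S" by blast
    have "x \<otimes> y = finprod G (\<lambda>s. s [^] f s \<otimes> s [^] g s) S"
      unfolding fg using cl by simp
    also have "\<dots> = finprod G (\<lambda>s. s [^] (f s + g s)) S"
      using assms(2) by (intro finprod_cong') (auto simp: nat_pow_mult)
    finally show "x \<otimes> y \<in> ?N" by (auto intro!: exI[of _ "\<lambda>s. f s + g s"])
  qed
  show "S \<subseteq> ?N"
  proof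
    fix a assume a: "a \<in> S"
    have "a = finprod G (\<lambda>s. if a = s then s else \<one>) S"
      using a assms by (subst finprod_singleton[of a S "\<lambda>s. s"]) auto
    also have "\<dots> = finprod G (\<lambda>s. s [^] (if a = s then 1 else 0 :: nat)) S"
      using assms(2) by (intro finprod_cong') auto
    finally show "a \<in> ?N" by (auto intro!: exI[of _ "\<lambda>s. if a = s then 1 else 0"])
  qed
qed

text \<open>
  Write each term as a product of powers of the generators; by Dickson's lemma two of the exponent
  vectors are comparable.
\<close>

lemma finitely_generated_divides_later:
  fixes G :: "'a monoid" (structure)
  assumes "comm_monoid G" "finitely_generated G" and x: "\<And>n::nat. x n \<in> carrier G"
  obtains m n where "m < n" "x m divides x n"
proof -
  interpret comm_monoid G by fact
  obtain S where S: "finite S" "S \<subseteq> carrier G"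
    and gen: "\<And>N. submonoid N G \<Longrightarrow> S \<subseteq> N \<Longrightarrow> N = carrier G"
    using assms(2) unfolding finitely_generated_def by auto
  have "\<exists>f :: 'a \<Rightarrow> nat. x n = finprod G (\<lambda>s. s [^] f s) S" for n
  proof -
    have "x n \<in> {finprod G (\<lambda>s. s [^] f s) S | f :: 'a \<Rightarrow> nat. True}"
      unfolding gen[OF submonoid_of_power_products[OF S]] by (rule x)
    then show ?thesis by simp
  qed
  then have "\<exists>f :: nat \<Rightarrow> 'a \<Rightarrow> nat. \<forall>n. x n = finprod G (\<lambda>s. s [^] f n s) S"
    by (intro choice allI)
  then obtain f :: "nat \<Rightarrow> 'a \<Rightarrow> nat" where f: "\<And>n. x n = finprod G (\<lambda>s. s [^] f n s) S"
    by blast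
  obtain r :: "nat \<Rightarrow> nat" where r: "strict_mono r" "\<And>s. s \<in> S \<Longrightarrow> mono (\<lambda>n. f (r n) s)"
    using dickson_subsequence[OF S(1), of f] by blast
  define m n where "m = r 0" and "n = r 1"
  have mn: "m < n" "\<And>s. s \<in> S \<Longrightarrow> f m s \<le> f n s"
    unfolding m_def n_def using strict_monoD[OF r(1)] monoD[OF r(2), of _ 0 1] by simp_all
  have "x n = finprod G (\<lambda>s. s [^] f m s \<otimes> s [^] (f n s - f m s)) S"
    unfolding f using S(2) mn(2) by (intro finprod_cong') (auto simp: nat_pow_mult subset_iff)
  also have "\<dots> = x m \<otimes> finprod G (\<lambda>s. s [^] (f n s - f m s)) S"
    unfolding f using S(2) by (intro finprod_multf) auto
  finally have "x n = x m \<otimes> finprod G (\<lambda>s. s [^] (f n s - f m s)) S" .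
  moreover have "finprod G (\<lambda>s. s [^] (f n s - f m s)) S \<in> carrier G"
    using S(2) by (intro finprod_closed) auto
  ultimately have "x m divides x n"
    unfolding factor_def by blast
  then show thesis using that mn(1) by blast
qed

text \<open>
  Cancellation holds up to elements absorbed by the common summand. Unlike cancellation itself, this
  holds in every finitely generated refinement monoid, for instance in the two-element semilattice,
  and stages of this kind are what one has to deal with even when the limit is stably finite.
\<close>

definition cancellative_up_to_absorption :: "'a monoid \<Rightarrow> bool" where
  "cancellative_up_to_absorption M \<longleftrightarrow>
     (\<forall>x\<in>carrier M. \<forall>y\<in>carrier M. \<forall>z\<in>carrier M. x \<otimes>\<^bsub>M\<^esub> y = x \<otimes>\<^bsub>M\<^esub> z \<longrightarrow>
        (\<exists>d\<in>carrier M. \<exists>u\<in>carrier M. \<exists>v\<in>carrier M. \<exists>s\<in>carrier M. \<exists>t\<in>carrier M.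
           y = d \<otimes>\<^bsub>M\<^esub> u \<and> z = d \<otimes>\<^bsub>M\<^esub> v \<and>
           x = x \<otimes>\<^bsub>M\<^esub> (u \<otimes>\<^bsub>M\<^esub> s) \<and> x = x \<otimes>\<^bsub>M\<^esub> (v \<otimes>\<^bsub>M\<^esub> t)))"

lemma cancellative_up_to_absorptionE:
  fixes M :: "'a monoid" (structure)
  assumes "cancellative_up_to_absorption M" "x \<in> carrier M" "y \<in> carrier M" "z \<in> carrier M"
    and "x \<otimes> y = x \<otimes> z"
  obtains d u v s t where "d \<in> carrier M" "u \<in> carrier M" "v \<in> carrier M"
    "s \<in> carrier M" "t \<in> carrier M" "y = d \<otimes> u" "z = d \<otimes> v"
    "x = x \<otimes> (u \<otimes> s)" "x = x \<otimes> (v \<otimes> t)"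
  using assms(1)[unfolded cancellative_up_to_absorption_def, rule_format, OF assms(2-5)] that
  by (elim bexE conjE)

text \<open>
  Refining \<open>x + y = x + z\<close> gives \<open>x = x\<^sub>1 + y\<^sub>1 = x\<^sub>1 + z\<^sub>1\<close>, \<open>y = d + y\<^sub>1\<close>, \<open>z = d + z\<^sub>1\<close>, so the same
  situation recurs with \<open>x\<^sub>1, y\<^sub>1, z\<^sub>1\<close>. Iterating, \<open>x\<^sub>m = x\<^sub>n + y\<^sub>n + \<cdots>\<close> for \<open>m < n\<close>. Finite generation
  provides \<open>m < n\<close> with \<open>x\<^sub>m \<le> x\<^sub>n\<close>; substituting, \<open>x\<^sub>m\<close>, and hence \<open>x\<close>, absorbs \<open>y\<^sub>n + \<cdots>\<close>. The
  same indices serve for \<open>z\<^sub>n\<close>.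
\<close>

lemma finitely_generated_refinement_imp_cancellative_up_to_absorption:
  fixes M :: "'a monoid" (structure)
  assumes ref: "refinement_monoid M" and fg: "finitely_generated M"
  shows "cancellative_up_to_absorption M"
  unfolding cancellative_up_to_absorption_def
proof (intro ballI impI)
  interpret comm_monoid M using ref by (simp add: refinement_monoid_def)
  fix x0 y0 z0
  assume 0: "x0 \<in> carrier M" "y0 \<in> carrier M" "z0 \<in> carrier M" "x0 \<otimes> y0 = x0 \<otimes> z0"
  \<comment> \<open>\<open>d\<close> collects what the refinements so far have split off from both \<open>y0\<close> and \<open>z0\<close>.\<close>
  define P where "P = (\<lambda>(n::nat) (x, y, z). x \<in> carrier M \<and> y \<in> carrier M \<and> z \<in> carrier M \<and>
    x \<otimes> y = x \<otimes> z \<and> (n = 0 \<longrightarrow> x = x0) \<and> (\<exists>d\<in>carrier M. y0 = d \<otimes> y \<and> z0 = d \<otimes> z))"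
  define Q where "Q = (\<lambda>(n::nat) (x :: 'a, y :: 'a, z :: 'a) (x', y', z'). x = x' \<otimes> y' \<and> x = x' \<otimes> z')"
  have start: "\<exists>w. P 0 w"
    using 0 by (intro exI[of _ "(x0, y0, z0)"]) (auto simp: P_def intro!: bexI[of _ "\<one>"])
  have successor: "\<exists>w'. P (Suc n) w' \<and> Q n w w'" if w: "P n w" for w n
  proof -
    obtain x y z where [simp]: "w = (x, y, z)" by (cases w)
    from w obtain d where d: "x \<in> carrier M" "y \<in> carrier M" "z \<in> carrier M" "x \<otimes> y = x \<otimes> z"
       "d \<in> carrier M" "y0 = d \<otimes> y" "z0 = d \<otimes> z" by (auto simp: P_def)
    obtain x' z' y' e where e: "x' \<in> carrier M" "z' \<in> carrier M" "y' \<in> carrier M" "e \<in> carrier M"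
      "x = x' \<otimes> z'" "y = y' \<otimes> e" "x = x' \<otimes> y'" "z = z' \<otimes> e"
      using ref d(1-4) unfolding refinement_monoid_def by blast
    have "y0 = (d \<otimes> e) \<otimes> y'" "z0 = (d \<otimes> e) \<otimes> z'"
      unfolding d(6,7) e(6,8) using d(5) e(1-4) by (simp_all add: m_ac)
    moreover have "x' \<otimes> y' = x' \<otimes> z'" using e(5,7) by simp
    moreover have "d \<otimes> e \<in> carrier M" using d(5) e(4) by simp
    ultimately have "P (Suc n) (x', y', z')"
      using e(1-4) unfolding P_def by auto
    moreover have "Q n w (x', y', z')" using e(5,7) by (simp add: Q_def)
    ultimately have "P (Suc n) (x', y', z') \<and> Q n w (x', y', z')" ..
    then show ?thesis by blast
  qed
  have "\<exists>w. \<forall>n. P n (w n) \<and> Q n (w n) (w (Suc n))"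
    using start successor by (rule dependent_nat_choice)
  then obtain w where w: "\<And>n. P n (w n)" "\<And>n. Q n (w n) (w (Suc n))" by blast
  define x y z where "x n = fst (w n)" and "y n = fst (snd (w n))" and "z n = snd (snd (w n))" for n
  have weq: "w n = (x n, y n, z n)" for n by (simp add: x_def y_def z_def)
  have cl [simp]: "x n \<in> carrier M" "y n \<in> carrier M" "z n \<in> carrier M" for n
    using w(1)[of n] by (auto simp: weq P_def)
  have x_0: "x 0 = x0" using w(1)[of 0] by (auto simp: weq P_def)
  have step: "x n = x (Suc n) \<otimes> y (Suc n)" "x n = x (Suc n) \<otimes> z (Suc n)" for n
    using w(2)[of n] by (auto simp: weq Q_def)
  \<comment> \<open>\<open>v\<close> stands for \<open>y\<close> or \<open>z\<close>: the iteration is symmetric in the two.\<close>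
  have descend: "\<exists>s\<in>carrier M. x m = x n \<otimes> (v n \<otimes> s)"
    if "m < n" and v: "\<And>n. v n \<in> carrier M" "\<And>n. x n = x (Suc n) \<otimes> v (Suc n)" for m n v
    using \<open>m < n\<close>
  proof (induction n)
    case (Suc n)
    show ?case
    proof (cases "m = n")
      case True
      show ?thesis using True v(2)[of n] v(1)[of "Suc n"] by (intro bexI[of _ "\<one>"]) simp_all
    next
      case False
      then obtain s where s: "s \<in> carrier M" "x m = x n \<otimes> (v n \<otimes> s)" using Suc by auto
      then have "x m = x (Suc n) \<otimes> (v (Suc n) \<otimes> (v n \<otimes> s))"
        using v(1) by (simp only: v(2)[of n] s(2)) (simp add: m_assoc)
      moreover have "v n \<otimes> s \<in> carrier M" using s v(1) by simp
      ultimately show ?thesis by blast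
    qed
  qed simp
  obtain m n where mn: "m < n" "x m divides x n"
    using finitely_generated_divides_later[OF comm_monoid_axioms fg, of x] by auto
  then obtain a where a: "a \<in> carrier M" "x n = x m \<otimes> a" by (auto simp: factor_def)
  have "\<exists>b\<in>carrier M. x0 = x m \<otimes> b"
  proof (cases "m = 0")
    case False
    then obtain s where "s \<in> carrier M" "x 0 = x m \<otimes> (y m \<otimes> s)"
      using descend[of 0 m y, OF _ cl(2) step(1)] by blast
    then show ?thesis unfolding x_0 by (intro bexI[of _ "y m \<otimes> s"]) auto
  qed (use 0 x_0 in \<open>auto intro!: bexI[of _ "\<one>"]\<close>)
  then obtain b where b: "b \<in> carrier M" "x0 = x m \<otimes> b" by blast
  have absorb: "\<exists>s\<in>carrier M. x0 = x0 \<otimes> (v n \<otimes> s)"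
    if v: "\<And>n. v n \<in> carrier M" "\<And>n. x n = x (Suc n) \<otimes> v (Suc n)" for v
  proof -
    obtain s where s: "s \<in> carrier M" "x m = x n \<otimes> (v n \<otimes> s)"
      using descend[OF mn(1) v] by blast
    have "x m = x m \<otimes> a \<otimes> (v n \<otimes> s)"
      using s(2) unfolding a(2) .
    also have "\<dots> = x m \<otimes> (v n \<otimes> (a \<otimes> s))"
      using a(1) s(1) v(1)[of n] by (simp add: m_ac)
    finally have "x0 = (x m \<otimes> (v n \<otimes> (a \<otimes> s))) \<otimes> b" using b(2) by simp
    also have "\<dots> = x0 \<otimes> (v n \<otimes> (a \<otimes> s))"
      unfolding b(2) using a(1) b(1) s(1) v(1)[of n] by (simp add: m_ac)
    finally show ?thesis using a(1) s(1) by (intro bexI[of _ "a \<otimes> s"]) simp_all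
  qed
  obtain s t where st: "s \<in> carrier M" "x0 = x0 \<otimes> (y n \<otimes> s)" "t \<in> carrier M" "x0 = x0 \<otimes> (z n \<otimes> t)"
    using absorb[OF cl(2) step(1)] absorb[OF cl(3) step(2)] by blast
  obtain d where d: "d \<in> carrier M" "y0 = d \<otimes> y n" "z0 = d \<otimes> z n"
    using w(1)[of n] by (auto simp: weq P_def)
  show "\<exists>d\<in>carrier M. \<exists>u\<in>carrier M. \<exists>v\<in>carrier M. \<exists>s\<in>carrier M. \<exists>t\<in>carrier M.
     y0 = d \<otimes> u \<and> z0 = d \<otimes> v \<and> x0 = x0 \<otimes> (u \<otimes> s) \<and> x0 = x0 \<otimes> (v \<otimes> t)"
    by (intro bexI[of _ d] bexI[of _ "y n"] bexI[of _ "z n"] bexI[of _ s] bexI[of _ t] conjI)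
       (fact d st cl)+
qed

section \<open>Inductive limits and tame monoids\<close>

locale ind_system =
  fixes I :: "'i set" and r and G :: "'i \<Rightarrow> 'b monoid" and \<phi>
  assumes system: "inductive_system I r G \<phi>"
begin

abbreviation cls :: "'i \<Rightarrow> 'b \<Rightarrow> ('i \<times> 'b) set" where
  "cls i x \<equiv> limit_rel I r G \<phi> `` {(i, x)}"

abbreviation L :: "('i \<times> 'b) set monoid" where
  "L \<equiv> inductive_limit I r G \<phi>"

lemma index: "(i, j) \<in> r \<Longrightarrow> i \<in> I \<and> j \<in> I"
  and index_refl: "i \<in> I \<Longrightarrow> (i, i) \<in> r"
  and index_trans: "(i, j) \<in> r \<Longrightarrow> (j, k) \<in> r \<Longrightarrow> (i, k) \<in> r"
proof -
  have "r \<subseteq> I \<times> I" "refl_on I r" "trans r"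
    using system by (simp_all add: inductive_system_def preorder_on_def)
  then show "(i, j) \<in> r \<Longrightarrow> i \<in> I \<and> j \<in> I" "i \<in> I \<Longrightarrow> (i, i) \<in> r"
    "(i, j) \<in> r \<Longrightarrow> (j, k) \<in> r \<Longrightarrow> (i, k) \<in> r"
    by (auto dest: refl_onD transD)
qed

lemma index_directed:
  assumes "i \<in> I" "j \<in> I" obtains k where "(i, k) \<in> r" "(j, k) \<in> r"
proof -
  have "\<forall>i\<in>I. \<forall>j\<in>I. \<exists>k\<in>I. (i, k) \<in> r \<and> (j, k) \<in> r"
    using system by (simp add: inductive_system_def)
  then show thesis using assms that by meson
qed

lemma stage_monoid: "i \<in> I \<Longrightarrow> comm_monoid (G i)"
  using system by (simp add: inductive_system_def)

lemma transition_closed [simp]: "(i, j) \<in> r \<Longrightarrow> x \<in> carrier (G i) \<Longrightarrow> \<phi> i j x \<in> carrier (G j)"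
  and transition_mult: "(i, j) \<in> r \<Longrightarrow> x \<in> carrier (G i) \<Longrightarrow> y \<in> carrier (G i) \<Longrightarrow>
    \<phi> i j (x \<otimes>\<^bsub>G i\<^esub> y) = \<phi> i j x \<otimes>\<^bsub>G j\<^esub> \<phi> i j y"
  and transition_refl: "i \<in> I \<Longrightarrow> x \<in> carrier (G i) \<Longrightarrow> \<phi> i i x = x"
  and transition_trans: "(i, j) \<in> r \<Longrightarrow> (j, k) \<in> r \<Longrightarrow> x \<in> carrier (G i) \<Longrightarrow>
    \<phi> j k (\<phi> i j x) = \<phi> i k x"
proof -
  assume "(i, j) \<in> r"
  then have "\<phi> i j \<in> hom (G i) (G j)" using system by (simp add: inductive_system_def)
  then show "x \<in> carrier (G i) \<Longrightarrow> \<phi> i j x \<in> carrier (G j)"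
    "x \<in> carrier (G i) \<Longrightarrow> y \<in> carrier (G i) \<Longrightarrow> \<phi> i j (x \<otimes>\<^bsub>G i\<^esub> y) = \<phi> i j x \<otimes>\<^bsub>G j\<^esub> \<phi> i j y"
    by (simp_all add: hom_in_carrier hom_mult)
qed (use system in \<open>simp_all add: inductive_system_def\<close>)

lemma stage_mult_closed [simp]:
  "i \<in> I \<Longrightarrow> x \<in> carrier (G i) \<Longrightarrow> y \<in> carrier (G i) \<Longrightarrow> x \<otimes>\<^bsub>G i\<^esub> y \<in> carrier (G i)"
  using stage_monoid by (simp add: comm_monoid.axioms(1) monoid.m_closed)

lemma limit_relI:
  "(i, k) \<in> r \<Longrightarrow> (j, k) \<in> r \<Longrightarrow> x \<in> carrier (G i) \<Longrightarrow> y \<in> carrier (G j) \<Longrightarrow>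
   \<phi> i k x = \<phi> j k y \<Longrightarrow> ((i, x), (j, y)) \<in> limit_rel I r G \<phi>"
  unfolding limit_rel_def using index by blast

lemma limit_relE:
  assumes "((i, x), (j, y)) \<in> limit_rel I r G \<phi>"
  obtains k where "(i, k) \<in> r" "(j, k) \<in> r" "x \<in> carrier (G i)" "y \<in> carrier (G j)"
    "\<phi> i k x = \<phi> j k y"
  using assms unfolding limit_rel_def by blast

lemma equiv_limit_rel: "equiv (SIGMA i:I. carrier (G i)) (limit_rel I r G \<phi>)"
proof (rule equivI)
  show "limit_rel I r G \<phi> \<subseteq> (SIGMA i:I. carrier (G i)) \<times> (SIGMA i:I. carrier (G i))"
    by (auto simp: limit_rel_def)
  show "refl_on (SIGMA i:I. carrier (G i)) (limit_rel I r G \<phi>)"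
    unfolding refl_on_def by clarify (rule limit_relI[OF index_refl index_refl], auto)
  show "sym (limit_rel I r G \<phi>)"
    unfolding sym_def by clarify (elim limit_relE, rule limit_relI, auto)
  show "trans (limit_rel I r G \<phi>)"
  proof (rule transI, clarify)
    fix i x j y l z
    assume xy: "((i, x), (j, y)) \<in> limit_rel I r G \<phi>" and yz: "((j, y), (l, z)) \<in> limit_rel I r G \<phi>"
    obtain k where k: "(i, k) \<in> r" "(j, k) \<in> r" "x \<in> carrier (G i)" "y \<in> carrier (G j)"
      "\<phi> i k x = \<phi> j k y" using xy by (rule limit_relE)
    obtain k' where k': "(j, k') \<in> r" "(l, k') \<in> r" "z \<in> carrier (G l)"
      "\<phi> j k' y = \<phi> l k' z" using yz by (rule limit_relE)
    obtain m where m: "(k, m) \<in> r" "(k', m) \<in> r"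
      using index_directed[of k k'] index[OF k(1)] index[OF k'(1)] by blast
    have "\<phi> i m x = \<phi> j m y"
      using transition_trans[OF k(1) m(1) k(3)] transition_trans[OF k(2) m(1) k(4)] k(5) by simp
    also have "\<phi> j m y = \<phi> l m z"
      using transition_trans[OF k'(1) m(2) k(4)] transition_trans[OF k'(2) m(2) k'(3)] k'(4) by simp
    finally have eq: "\<phi> i m x = \<phi> l m z" .
    show "((i, x), (l, z)) \<in> limit_rel I r G \<phi>"
      using index_trans[OF k(1) m(1)] index_trans[OF k'(2) m(2)] k(3) k'(3) eq by (rule limit_relI)
  qed
qed

lemma cls_eq_iff:
  assumes "i \<in> I" "j \<in> I" "x \<in> carrier (G i)" "y \<in> carrier (G j)"
  shows "cls i x = cls j y \<longleftrightarrow> ((i, x), (j, y)) \<in> limit_rel I r G \<phi>"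
  using assms by (subst eq_equiv_class_iff[OF equiv_limit_rel]) auto

lemma cls_transition:
  assumes "(i, k) \<in> r" "x \<in> carrier (G i)"
  shows "cls k (\<phi> i k x) = cls i x"
  using assms index[OF assms(1)] index_refl
  by (subst cls_eq_iff) (auto intro!: limit_relI[of _ k] simp: transition_refl)

lemma carrier_limit: "carrier L = {cls i x | i x. i \<in> I \<and> x \<in> carrier (G i)}"
  by (auto simp: inductive_limit_def quotient_def)

text \<open>
  The product of the limit is a union over all representatives of the factors and all common later
  stages. All these choices give one class, since any two of them agree at a sufficiently late stage.
\<close>

lemma cls_mult:
  assumes i: "i \<in> I" "x \<in> carrier (G i)" "y \<in> carrier (G i)"
  shows "cls i x \<otimes>\<^bsub>L\<^esub> cls i y = cls i (x \<otimes>\<^bsub>G i\<^esub> y)"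
proof -
  have eq: "cls k (\<phi> j k x' \<otimes>\<^bsub>G k\<^esub> \<phi> l k y') = cls i (x \<otimes>\<^bsub>G i\<^esub> y)"
    if mem: "(j, x') \<in> cls i x" "(l, y') \<in> cls i y" "(j, k) \<in> r" "(l, k) \<in> r" for j l x' y' k
  proof -
    obtain k1 where k1: "(i, k1) \<in> r" "(j, k1) \<in> r" "x' \<in> carrier (G j)" "\<phi> i k1 x = \<phi> j k1 x'"
      using mem(1) unfolding Image_singleton_iff by (rule limit_relE)
    obtain k2 where k2: "(i, k2) \<in> r" "(l, k2) \<in> r" "y' \<in> carrier (G l)" "\<phi> i k2 y = \<phi> l k2 y'"
      using mem(2) unfolding Image_singleton_iff by (rule limit_relE)
    obtain k3 where k3: "(k1, k3) \<in> r" "(k2, k3) \<in> r"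
      using index_directed[of k1 k2] index[OF k1(1)] index[OF k2(1)] by blast
    obtain m where m: "(k3, m) \<in> r" "(k, m) \<in> r"
      using index_directed[of k3 k] index[OF k3(1)] index[OF mem(3)] by blast
    have km: "(k1, m) \<in> r" "(k2, m) \<in> r" "(i, m) \<in> r"
      using index_trans[OF k3(1) m(1)] index_trans[OF k3(2) m(1)] index_trans[OF k1(1)] by simp_all
    have "\<phi> k m (\<phi> j k x' \<otimes>\<^bsub>G k\<^esub> \<phi> l k y') = \<phi> j m x' \<otimes>\<^bsub>G m\<^esub> \<phi> l m y'"
      using transition_mult[OF m(2)] transition_trans[OF mem(3) m(2) k1(3)]
        transition_trans[OF mem(4) m(2) k2(3)] mem(3,4) k1(3) k2(3) by simp
    also have "\<phi> j m x' = \<phi> i m x"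
      using transition_trans[OF k1(1) km(1) i(2)] transition_trans[OF k1(2) km(1) k1(3)] k1(4) by simp
    also have "\<phi> l m y' = \<phi> i m y"
      using transition_trans[OF k2(1) km(2) i(3)] transition_trans[OF k2(2) km(2) k2(3)] k2(4) by simp
    also have "\<phi> i m x \<otimes>\<^bsub>G m\<^esub> \<phi> i m y = \<phi> i m (x \<otimes>\<^bsub>G i\<^esub> y)"
      using i km by (simp add: transition_mult)
    finally have "((k, \<phi> j k x' \<otimes>\<^bsub>G k\<^esub> \<phi> l k y'), (i, x \<otimes>\<^bsub>G i\<^esub> y)) \<in> limit_rel I r G \<phi>"
      using mem(3,4) i k1(3) k2(3) index[OF m(2)]
      by (intro limit_relI[OF m(2) km(3)]) (simp_all del: Image_singleton_iff)
    then show ?thesis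
      by (rule equiv_class_eq[OF equiv_limit_rel])
  qed
  let ?A = "cls i x" and ?B = "cls i y" and ?C = "cls i (x \<otimes>\<^bsub>G i\<^esub> y)"
  let ?D = "\<lambda>a b k. cls k (\<phi> (fst a) k (snd a) \<otimes>\<^bsub>G k\<^esub> \<phi> (fst b) k (snd b))"
  let ?K = "\<lambda>a b. {k. (fst a, k) \<in> r \<and> (fst b, k) \<in> r}"
  have D: "?D a b k = ?C" if "a \<in> ?A" "b \<in> ?B" "k \<in> ?K a b" for a b k
    using eq[of "fst a" "snd a" "fst b" "snd b" k] that by simp
  have self: "(i, x) \<in> ?A" "(i, y) \<in> ?B" "i \<in> ?K (i, x) (i, y)"
    using i equiv_class_self[OF equiv_limit_rel, of "(i, x)"]
      equiv_class_self[OF equiv_limit_rel, of "(i, y)"] index_refl by simp_all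
  have "(\<Union>a\<in>?A. \<Union>b\<in>?B. \<Union>k\<in>?K a b. ?D a b k) = ?C"
  proof (rule equalityI)
    show "(\<Union>a\<in>?A. \<Union>b\<in>?B. \<Union>k\<in>?K a b. ?D a b k) \<subseteq> ?C"
      by (intro UN_least) (simp only: D subset_refl)
    show "?C \<subseteq> (\<Union>a\<in>?A. \<Union>b\<in>?B. \<Union>k\<in>?K a b. ?D a b k)"
    proof
      fix w assume "w \<in> ?C"
      then have w: "w \<in> ?D (i, x) (i, y) i" by (simp only: D[OF self])
      show "w \<in> (\<Union>a\<in>?A. \<Union>b\<in>?B. \<Union>k\<in>?K a b. ?D a b k)"
        by (rule UN_I, rule self(1), rule UN_I, rule self(2), rule UN_I, rule self(3), rule w)
    qed
  qed
  then show ?thesis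
    unfolding inductive_limit_def by (simp only: monoid.simps case_prod_unfold)
qed

lemma same_stage:
  assumes "X \<in> carrier L" "Y \<in> carrier L" "Z \<in> carrier L"
  obtains i x y z where "i \<in> I" "x \<in> carrier (G i)" "y \<in> carrier (G i)" "z \<in> carrier (G i)"
    "X = cls i x" "Y = cls i y" "Z = cls i z"
proof -
  obtain i x j y k z where X: "i \<in> I" "x \<in> carrier (G i)" "X = cls i x"
    and Y: "j \<in> I" "y \<in> carrier (G j)" "Y = cls j y" and Z: "k \<in> I" "z \<in> carrier (G k)" "Z = cls k z"
    using assms unfolding carrier_limit by blast
  obtain l where l: "(i, l) \<in> r" "(j, l) \<in> r" using index_directed[OF X(1) Y(1)] by blast
  obtain m where m: "(l, m) \<in> r" "(k, m) \<in> r" using index_directed[of l k] index[OF l(1)] Z(1) by blast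
  have ij: "(i, m) \<in> r" "(j, m) \<in> r"
    using index_trans[OF l(1) m(1)] index_trans[OF l(2) m(1)] by simp_all
  show thesis
    using index[OF m(1)] X Y Z m ij
    by (intro that[of m "\<phi> i m x" "\<phi> j m y" "\<phi> k m z"]) (simp_all only: cls_transition transition_closed)
qed

text \<open>
  An equation between three elements of the limit already holds at some stage, and the witnesses
  found there are mapped to the limit.
\<close>

lemma limit_cancellative_up_to_absorption:
  assumes "\<And>i. i \<in> I \<Longrightarrow> cancellative_up_to_absorption (G i)"
  shows "cancellative_up_to_absorption L"
  unfolding cancellative_up_to_absorption_def
proof (intro ballI impI)
  fix X Y Z
  assume XYZ: "X \<in> carrier L" "Y \<in> carrier L" "Z \<in> carrier L" and eq: "X \<otimes>\<^bsub>L\<^esub> Y = X \<otimes>\<^bsub>L\<^esub> Z"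
  from XYZ obtain i x y z where i: "i \<in> I" "x \<in> carrier (G i)" "y \<in> carrier (G i)" "z \<in> carrier (G i)"
    and [simp]: "X = cls i x" "Y = cls i y" "Z = cls i z" by (rule same_stage)
  have "cls i (x \<otimes>\<^bsub>G i\<^esub> y) = cls i (x \<otimes>\<^bsub>G i\<^esub> z)"
    using eq i by (simp add: cls_mult)
  then obtain k where k: "(i, k) \<in> r" "\<phi> i k (x \<otimes>\<^bsub>G i\<^esub> y) = \<phi> i k (x \<otimes>\<^bsub>G i\<^esub> z)"
    using i unfolding cls_eq_iff[OF i(1) i(1) stage_mult_closed[OF i(1,2,3)] stage_mult_closed[OF i(1,2,4)]]
    by (elim limit_relE) simp
  have k': "k \<in> I" "\<phi> i k x \<otimes>\<^bsub>G k\<^esub> \<phi> i k y = \<phi> i k x \<otimes>\<^bsub>G k\<^esub> \<phi> i k z"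
    using k(2) i index[OF k(1)] by (simp_all only: transition_mult[OF k(1)])
  obtain d u v s t where c: "d \<in> carrier (G k)" "u \<in> carrier (G k)" "v \<in> carrier (G k)"
      "s \<in> carrier (G k)" "t \<in> carrier (G k)"
    and e: "\<phi> i k y = d \<otimes>\<^bsub>G k\<^esub> u" "\<phi> i k z = d \<otimes>\<^bsub>G k\<^esub> v"
      "\<phi> i k x = \<phi> i k x \<otimes>\<^bsub>G k\<^esub> (u \<otimes>\<^bsub>G k\<^esub> s)" "\<phi> i k x = \<phi> i k x \<otimes>\<^bsub>G k\<^esub> (v \<otimes>\<^bsub>G k\<^esub> t)"
    using assms[OF k'(1)] transition_closed[OF k(1) i(2)] transition_closed[OF k(1) i(3)]
      transition_closed[OF k(1) i(4)] k'(2)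
    by (rule cancellative_up_to_absorptionE)
  have XYZk: "X = cls k (\<phi> i k x)" "Y = cls k (\<phi> i k y)" "Z = cls k (\<phi> i k z)"
    using i by (simp_all add: cls_transition[OF k(1)] del: Image_singleton_iff)
  have mem: "cls k w \<in> carrier L" if "w \<in> carrier (G k)" for w
    using that k' unfolding carrier_limit by blast
  have "Y = cls k d \<otimes>\<^bsub>L\<^esub> cls k u" "Z = cls k d \<otimes>\<^bsub>L\<^esub> cls k v"
      "X = X \<otimes>\<^bsub>L\<^esub> (cls k u \<otimes>\<^bsub>L\<^esub> cls k s)" "X = X \<otimes>\<^bsub>L\<^esub> (cls k v \<otimes>\<^bsub>L\<^esub> cls k t)"
    unfolding XYZk using c e transition_closed[OF k(1)] i
    by (simp_all only: cls_mult[OF k'(1)] stage_mult_closed[OF k'(1)])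
  then show "\<exists>d\<in>carrier L. \<exists>u\<in>carrier L. \<exists>v\<in>carrier L. \<exists>s\<in>carrier L. \<exists>t\<in>carrier L.
     Y = d \<otimes>\<^bsub>L\<^esub> u \<and> Z = d \<otimes>\<^bsub>L\<^esub> v \<and> X = X \<otimes>\<^bsub>L\<^esub> (u \<otimes>\<^bsub>L\<^esub> s) \<and> X = X \<otimes>\<^bsub>L\<^esub> (v \<otimes>\<^bsub>L\<^esub> t)"
    using mem[OF c(1)] mem[OF c(2)] mem[OF c(3)] mem[OF c(4)] mem[OF c(5)] by blast
qed

end

lemma cancellative_up_to_absorption_iso:
  assumes "cancellative_up_to_absorption N" "M \<cong> N" "comm_monoid M"
  shows "cancellative_up_to_absorption M"
proof -
  interpret comm_monoid M by fact
  obtain h where h: "h \<in> hom M N" "h ` carrier M = carrier N" "inj_on h (carrier M)"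
    using assms(2) by (auto simp: is_iso_def iso_iff)
  have m: "h x \<otimes>\<^bsub>N\<^esub> h y = h (x \<otimes>\<^bsub>M\<^esub> y)" if "x \<in> carrier M" "y \<in> carrier M" for x y
    using h(1) that by (simp add: hom_mult)
  show ?thesis
    unfolding cancellative_up_to_absorption_def
  proof (intro ballI impI)
    fix x y z assume x: "x \<in> carrier M" "y \<in> carrier M" "z \<in> carrier M"
      and eq: "x \<otimes>\<^bsub>M\<^esub> y = x \<otimes>\<^bsub>M\<^esub> z"
    have "h x \<in> carrier N" "h y \<in> carrier N" "h z \<in> carrier N"
      "h x \<otimes>\<^bsub>N\<^esub> h y = h x \<otimes>\<^bsub>N\<^esub> h z"
      using x eq h(2) by (auto simp: m)
    then obtain d' u' v' s' t' where n: "d' \<in> h ` carrier M" "u' \<in> h ` carrier M"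
        "v' \<in> h ` carrier M" "s' \<in> h ` carrier M" "t' \<in> h ` carrier M"
      and n': "h y = d' \<otimes>\<^bsub>N\<^esub> u'" "h z = d' \<otimes>\<^bsub>N\<^esub> v'"
        "h x = h x \<otimes>\<^bsub>N\<^esub> (u' \<otimes>\<^bsub>N\<^esub> s')" "h x = h x \<otimes>\<^bsub>N\<^esub> (v' \<otimes>\<^bsub>N\<^esub> t')"
      unfolding h(2) by (rule cancellative_up_to_absorptionE[OF assms(1)])
    obtain d u v s t where c: "d \<in> carrier M" "u \<in> carrier M" "v \<in> carrier M"
      "s \<in> carrier M" "t \<in> carrier M"
      and [simp]: "d' = h d" "u' = h u" "v' = h v" "s' = h s" "t' = h t"
      using n by (elim imageE) (rule that)
    have e: "h y = h (d \<otimes>\<^bsub>M\<^esub> u)" "h z = h (d \<otimes>\<^bsub>M\<^esub> v)"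
      "h x = h (x \<otimes>\<^bsub>M\<^esub> (u \<otimes>\<^bsub>M\<^esub> s))" "h x = h (x \<otimes>\<^bsub>M\<^esub> (v \<otimes>\<^bsub>M\<^esub> t))"
      using n'(1,2) c x by (simp add: m, simp add: m, subst n'(3), simp add: m, subst n'(4), simp add: m)
    have "y = d \<otimes>\<^bsub>M\<^esub> u" "z = d \<otimes>\<^bsub>M\<^esub> v"
      "x = x \<otimes>\<^bsub>M\<^esub> (u \<otimes>\<^bsub>M\<^esub> s)" "x = x \<otimes>\<^bsub>M\<^esub> (v \<otimes>\<^bsub>M\<^esub> t)"
      using c x inj_onD[OF h(3) e(1)] inj_onD[OF h(3) e(2)] inj_onD[OF h(3) e(3)]
        inj_onD[OF h(3) e(4)] by simp_all
    then show "\<exists>d\<in>carrier M. \<exists>u\<in>carrier M. \<exists>v\<in>carrier M. \<exists>s\<in>carrier M. \<exists>t\<in>carrier M.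
       y = d \<otimes>\<^bsub>M\<^esub> u \<and> z = d \<otimes>\<^bsub>M\<^esub> v \<and>
       x = x \<otimes>\<^bsub>M\<^esub> (u \<otimes>\<^bsub>M\<^esub> s) \<and> x = x \<otimes>\<^bsub>M\<^esub> (v \<otimes>\<^bsub>M\<^esub> t)"
      using c by blast
  qed
qed

lemma tame_imp_cancellative_up_to_absorption:
  assumes "tame TYPE('i) TYPE('b) M"
  shows "cancellative_up_to_absorption M"
proof -
  obtain I :: "'i set" and r and G :: "'i \<Rightarrow> 'b monoid" and \<phi> where s: "inductive_system I r G \<phi>"
    "\<And>i. i \<in> I \<Longrightarrow> refinement_monoid (G i) \<and> finitely_generated (G i)"
    "M \<cong> inductive_limit I r G \<phi>" and M: "refinement_monoid M"
    using assms unfolding tame_def by (elim conjE exE) simp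
  interpret ind_system I r G \<phi> by standard (fact s(1))
  have "cancellative_up_to_absorption (inductive_limit I r G \<phi>)"
    by (rule limit_cancellative_up_to_absorption,
        rule finitely_generated_refinement_imp_cancellative_up_to_absorption)
       (simp_all add: s(2))
  moreover have "comm_monoid M" using M by (simp add: refinement_monoid_def)
  ultimately show ?thesis
    by (rule cancellative_up_to_absorption_iso[OF _ s(3)])
qed

text \<open>
  If \<open>x = x + (u + s)\<close>, then stable finiteness gives \<open>u + s = 0\<close> and conicality \<open>u = 0\<close>.
\<close>

lemma tame_imp_cancellative:
  fixes M :: "'a monoid" (structure)
  assumes "tame TYPE('i) TYPE('b) M" "conical M" "stably_finite M"
    and "x \<in> carrier M" "y \<in> carrier M" "z \<in> carrier M" "x \<otimes> y = x \<otimes> z"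
  shows "y = z"
proof -
  interpret comm_monoid M using assms(1) by (simp add: tame_def refinement_monoid_def)
  obtain d u v s t where c: "d \<in> carrier M" "u \<in> carrier M" "v \<in> carrier M"
      "s \<in> carrier M" "t \<in> carrier M"
    and e: "y = d \<otimes> u" "z = d \<otimes> v" "x = x \<otimes> (u \<otimes> s)" "x = x \<otimes> (v \<otimes> t)"
    using tame_imp_cancellative_up_to_absorption[OF assms(1)] assms(4-7)
    by (rule cancellative_up_to_absorptionE)
  have "u \<otimes> s = \<one>" "v \<otimes> t = \<one>"
    using assms(3)[unfolded stably_finite_def, rule_format, OF assms(4) _ e(3)[symmetric]]
      assms(3)[unfolded stably_finite_def, rule_format, OF assms(4) _ e(4)[symmetric]] c by simp_all
  then have "u = \<one>" "v = \<one>"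
    using assms(2)[unfolded conical_def, rule_format, OF c(2) c(4)]
      assms(2)[unfolded conical_def, rule_format, OF c(3) c(5)] by simp_all
  then show ?thesis using e(1,2) by simp
qed

section \<open>Quotients, presentations and isomorphisms\<close>

lemma iso_sym_if_closed:
  assumes "M \<cong> N" and closed: "\<And>x y. x \<in> carrier M \<Longrightarrow> y \<in> carrier M \<Longrightarrow> x \<otimes>\<^bsub>M\<^esub> y \<in> carrier M"
  shows "N \<cong> M"
proof -
  obtain h where h: "h \<in> hom M N" "bij_betw h (carrier M) (carrier N)"
    using assms(1) by (auto simp: is_iso_def iso_def)
  let ?g = "inv_into (carrier M) h"
  have g: "bij_betw ?g (carrier N) (carrier M)" using h(2) by (rule bij_betw_inv_into)
  have hg: "h (?g x) = x" if "x \<in> carrier N" for x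
    using h(2) that by (rule bij_betw_inv_into_right)
  have gh: "?g (h x) = x" if "x \<in> carrier M" for x
    using h(2) that by (rule bij_betw_inv_into_left)
  have "?g \<in> hom N M"
  proof (rule homI)
    fix x y assume x: "x \<in> carrier N" "y \<in> carrier N"
    then show mem: "?g x \<in> carrier M" using bij_betwE[OF g] by blast
    have "?g y \<in> carrier M" using x bij_betwE[OF g] by blast
    then show "?g (x \<otimes>\<^bsub>N\<^esub> y) = ?g x \<otimes>\<^bsub>M\<^esub> ?g y"
      using mem hom_mult[OF h(1), of "?g x" "?g y"] gh[of "?g x \<otimes>\<^bsub>M\<^esub> ?g y"] hg[OF x(1)] hg[OF x(2)]
        closed[of "?g x" "?g y"] by simp
  qed
  then show ?thesis using g by (intro is_isoI isoI)
qed

text \<open>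
  A quotient by the kernel of a surjective homomorphism \<open>f\<close>. Presented monoids and quotients by
  o-ideals both take this form once a candidate for the result is known.
\<close>

locale kernel_quotient = comm_monoid M for M :: "'a monoid" (structure) +
  fixes N :: "'b monoid" and f :: "'a \<Rightarrow> 'b" and r :: "('a \<times> 'a) set"
  assumes hom: "f \<in> hom M N" and surj: "f ` carrier M = carrier N"
    and kernel: "\<And>x y. (x, y) \<in> r \<longleftrightarrow> x \<in> carrier M \<and> y \<in> carrier M \<and> f x = f y"
begin

lemma class_eq: "x \<in> carrier M \<Longrightarrow> r `` {x} = {y \<in> carrier M. f y = f x}"
  by (auto simp: kernel)

lemma class_mult:
  assumes "x \<in> carrier M" "y \<in> carrier M"
  shows "r `` {x} \<otimes>\<^bsub>quotient_monoid M r\<^esub> r `` {y} = r `` {x \<otimes> y}"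
proof -
  have "r `` {x' \<otimes> y'} = r `` {x \<otimes> y}" if "x' \<in> r `` {x}" "y' \<in> r `` {y}" for x' y'
  proof -
    have "x' \<in> carrier M" "y' \<in> carrier M" "f x' = f x" "f y' = f y"
      using that assms by (simp_all add: class_eq)
    then show ?thesis using assms by (simp add: class_eq hom_mult[OF hom])
  qed
  then have "(\<Union>x'\<in>r `` {x}. \<Union>y'\<in>r `` {y}. r `` {x' \<otimes> y'}) = (\<Union>x'\<in>r `` {x}. \<Union>y'\<in>r `` {y}. r `` {x \<otimes> y})"
    by (intro SUP_cong HOL.refl)
  also have "\<dots> = r `` {x \<otimes> y}"
  proof -
    have "r `` {x} \<noteq> {}" "r `` {y} \<noteq> {}" using assms by (auto simp: class_eq)
    then show ?thesis by (simp only: UN_constant if_False)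
  qed
  finally show ?thesis
    by (simp only: quotient_monoid_def monoid.simps)
qed

lemma carrier_quotient: "carrier (quotient_monoid M r) = (\<lambda>x. r `` {x}) ` carrier M"
  by (auto simp: quotient_monoid_def quotient_def)

lemma comm_monoid_quotient: "comm_monoid (quotient_monoid M r)"
proof (rule comm_monoidI)
  have one: "\<one>\<^bsub>quotient_monoid M r\<^esub> = r `` {\<one>}" by (simp add: quotient_monoid_def)
  show "\<one>\<^bsub>quotient_monoid M r\<^esub> \<in> carrier (quotient_monoid M r)"
    unfolding one carrier_quotient by (rule imageI) simp
  fix X Y Z
  assume "X \<in> carrier (quotient_monoid M r)" "Y \<in> carrier (quotient_monoid M r)"
    "Z \<in> carrier (quotient_monoid M r)"
  then obtain x y z where [simp]: "x \<in> carrier M" "y \<in> carrier M" "z \<in> carrier M"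
    and eq: "X = r `` {x}" "Y = r `` {y}" "Z = r `` {z}"
    unfolding carrier_quotient by (elim imageE) (rule that)
  show "X \<otimes>\<^bsub>quotient_monoid M r\<^esub> Y \<in> carrier (quotient_monoid M r)"
    unfolding eq carrier_quotient
    by (rule image_eqI[of _ _ "x \<otimes> y"]) (simp_all add: class_mult del: Image_singleton_iff)
  show "X \<otimes>\<^bsub>quotient_monoid M r\<^esub> Y = Y \<otimes>\<^bsub>quotient_monoid M r\<^esub> X"
    unfolding eq by (simp add: class_mult m_comm del: Image_singleton_iff)
  show "X \<otimes>\<^bsub>quotient_monoid M r\<^esub> Y \<otimes>\<^bsub>quotient_monoid M r\<^esub> Z =
      X \<otimes>\<^bsub>quotient_monoid M r\<^esub> (Y \<otimes>\<^bsub>quotient_monoid M r\<^esub> Z)"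
    unfolding eq by (simp add: class_mult m_assoc del: Image_singleton_iff)
  show "\<one>\<^bsub>quotient_monoid M r\<^esub> \<otimes>\<^bsub>quotient_monoid M r\<^esub> X = X"
    unfolding eq one by (simp add: class_mult del: Image_singleton_iff)
qed

lemma quotient_iso: "quotient_monoid M r \<cong> N"
proof (rule is_isoI)
  let ?g = "\<lambda>X. the_elem (f ` X)"
  have g: "?g (r `` {x}) = f x" if "x \<in> carrier M" for x
  proof -
    have "f ` (r `` {x}) = {f x}" using that by (auto simp: class_eq)
    then show ?thesis by simp
  qed
  show "?g \<in> iso (quotient_monoid M r) N"
    unfolding iso_iff
  proof (intro conjI)
    show "?g \<in> hom (quotient_monoid M r) N"
    proof (rule homI)
      fix X Y assume "X \<in> carrier (quotient_monoid M r)" "Y \<in> carrier (quotient_monoid M r)"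
      then obtain x y where [simp]: "x \<in> carrier M" "y \<in> carrier M"
        and eq: "X = r `` {x}" "Y = r `` {y}"
        unfolding carrier_quotient by (elim imageE) (rule that)
      show "?g X \<in> carrier N" unfolding eq by (simp add: g hom_in_carrier[OF hom])
      show "?g (X \<otimes>\<^bsub>quotient_monoid M r\<^esub> Y) = ?g X \<otimes>\<^bsub>N\<^esub> ?g Y"
        unfolding eq by (simp add: class_mult g hom_mult[OF hom])
    qed
    have "?g ` carrier (quotient_monoid M r) = f ` carrier M"
      unfolding carrier_quotient image_image by (rule image_cong[OF HOL.refl]) (rule g)
    then show "?g ` carrier (quotient_monoid M r) = carrier N" by (simp only: surj)
    show "inj_on ?g (carrier (quotient_monoid M r))"
      unfolding carrier_quotient
    proof (rule inj_onI, elim imageE)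
      fix X Y x y assume "?g X = ?g Y" and X: "X = r `` {x}" "x \<in> carrier M" "Y = r `` {y}" "y \<in> carrier M"
      then have "f x = f y" by (simp only: g)
      then show "X = Y" using X by (simp add: class_eq)
    qed
  qed
qed

end

text \<open>
  The ideal lives in \<open>M\<close>, but the kernel condition only has to be checked in a concrete copy \<open>A\<close> of
  \<open>M\<close>.
\<close>

lemma o_ideal_quotient_iso:
  fixes M :: "'a monoid" and A :: "'b monoid" and N :: "'c monoid"
  assumes "comm_monoid M" and h: "h \<in> iso M A" and f: "f \<in> hom A N" "f ` carrier A = carrier N"
    and J: "J \<subseteq> carrier A"
    and kernel: "\<And>x y. x \<in> carrier A \<Longrightarrow> y \<in> carrier A \<Longrightarrow>
      f x = f y \<longleftrightarrow> (\<exists>a\<in>J. \<exists>b\<in>J. x \<otimes>\<^bsub>A\<^esub> a = y \<otimes>\<^bsub>A\<^esub> b)"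
  shows "M //\<^sub>o {x \<in> carrier M. h x \<in> J} \<cong> N"
    and "N \<cong> M //\<^sub>o {x \<in> carrier M. h x \<in> J}"
  unfolding o_ideal_quotient_def
proof -
  interpret comm_monoid M by fact
  have hm: "h \<in> hom M A" "h ` carrier M = carrier A" "inj_on h (carrier M)"
    using h by (simp_all add: iso_iff)
  have eq: "x \<otimes>\<^bsub>M\<^esub> a = y \<otimes>\<^bsub>M\<^esub> b \<longleftrightarrow> h x \<otimes>\<^bsub>A\<^esub> h a = h y \<otimes>\<^bsub>A\<^esub> h b"
    if "x \<in> carrier M" "y \<in> carrier M" "a \<in> carrier M" "b \<in> carrier M" for x y a b
    using that by (simp add: hom_mult[OF hm(1), symmetric] inj_on_eq_iff[OF hm(3)])
  let ?J = "{x \<in> carrier M. h x \<in> J}"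
  have J_image: "h ` ?J = J" using J hm(2) by auto
  interpret kernel_quotient M N "f \<circ> h" "o_ideal_cong M ?J"
  proof
    show "f \<circ> h \<in> hom M N" using hm(1) f(1) by (rule hom_compose)
    show "(f \<circ> h) ` carrier M = carrier N" by (simp only: image_comp[symmetric] hm(2) f(2))
    fix x y
    show "(x, y) \<in> o_ideal_cong M ?J \<longleftrightarrow>
      x \<in> carrier M \<and> y \<in> carrier M \<and> (f \<circ> h) x = (f \<circ> h) y"
    proof (cases "x \<in> carrier M \<and> y \<in> carrier M")
      case True
      have "(\<exists>a\<in>?J. \<exists>b\<in>?J. x \<otimes>\<^bsub>M\<^esub> a = y \<otimes>\<^bsub>M\<^esub> b) \<longleftrightarrow>
        (\<exists>a\<in>?J. \<exists>b\<in>?J. h x \<otimes>\<^bsub>A\<^esub> h a = h y \<otimes>\<^bsub>A\<^esub> h b)"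
        using True by (intro bex_cong HOL.refl) (simp add: eq)
      also have "\<dots> \<longleftrightarrow> (\<exists>a\<in>h ` ?J. \<exists>b\<in>h ` ?J. h x \<otimes>\<^bsub>A\<^esub> a = h y \<otimes>\<^bsub>A\<^esub> b)"
        by (simp only: bex_simps)
      also have "\<dots> \<longleftrightarrow> f (h x) = f (h y)"
        unfolding J_image using True hm(2) by (intro kernel[symmetric]) auto
      finally show ?thesis using True by (simp add: o_ideal_cong_def)
    qed (auto simp: o_ideal_cong_def)
  qed
  show "quotient_monoid M (o_ideal_cong M ?J) \<cong> N" by (rule quotient_iso)
  then show "N \<cong> quotient_monoid M (o_ideal_cong M ?J)"
    by (rule iso_sym_if_closed) (rule monoid.m_closed[OF comm_monoid.axioms(1)[OF comm_monoid_quotient]])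
qed

locale comm_monoid_iso = M: comm_monoid M + N: comm_monoid N
  for M :: "'a monoid" and N :: "'b monoid" +
  fixes h
  assumes iso: "h \<in> iso M N"
begin

lemma map_mult: "x \<in> carrier M \<Longrightarrow> y \<in> carrier M \<Longrightarrow> h x \<otimes>\<^bsub>N\<^esub> h y = h (x \<otimes>\<^bsub>M\<^esub> y)"
  using hom_mult[of h M N] iso by (simp add: iso_iff)

lemma image_carrier: "carrier N = h ` carrier M"
  using iso by (simp add: iso_iff)

lemma map_closed [simp]: "x \<in> carrier M \<Longrightarrow> h x \<in> carrier N"
  by (simp add: image_carrier)

lemma map_eq_iff: "x \<in> carrier M \<Longrightarrow> y \<in> carrier M \<Longrightarrow> h x = h y \<longleftrightarrow> x = y"
  using inj_on_eq_iff[of h "carrier M"] iso by (simp add: iso_iff)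

lemma map_one: "h \<one>\<^bsub>M\<^esub> = \<one>\<^bsub>N\<^esub>"
proof -
  obtain e where e: "e \<in> carrier M" "\<one>\<^bsub>N\<^esub> = h e"
    using N.one_closed unfolding image_carrier by (elim imageE)
  have "h \<one>\<^bsub>M\<^esub> \<otimes>\<^bsub>N\<^esub> h e = h e" using e(1) by (simp add: map_mult)
  then show ?thesis using e(2) by (metis N.r_one M.one_closed map_closed)
qed

lemma map_pow: "x \<in> carrier M \<Longrightarrow> h x [^]\<^bsub>N\<^esub> (n::nat) = h (x [^]\<^bsub>M\<^esub> n)"
  by (induction n) (simp_all add: map_one map_mult)

lemma map_divides:
  assumes "x \<in> carrier M" "y \<in> carrier M"
  shows "h x divides\<^bsub>N\<^esub> h y \<longleftrightarrow> x divides\<^bsub>M\<^esub> y"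
  using assms by (simp add: factor_def image_carrier map_mult map_eq_iff cong: bex_cong)

lemma map_Units: "x \<in> carrier M \<Longrightarrow> h x \<in> Units N \<longleftrightarrow> x \<in> Units M"
  by (simp add: Units_def image_carrier map_mult map_eq_iff map_one[symmetric] cong: bex_cong)

lemmas transfer_simps = image_carrier map_mult map_eq_iff map_pow map_divides map_Units
  map_one[symmetric]

lemma refinement_iff: "refinement_monoid N \<longleftrightarrow> refinement_monoid M"
  using M.comm_monoid_axioms N.comm_monoid_axioms
  by (simp add: refinement_monoid_def transfer_simps cong: ball_cong bex_cong)

lemma conical_iff: "conical N \<longleftrightarrow> conical M"
  by (simp add: conical_def transfer_simps cong: ball_cong)

lemma stably_finite_iff: "stably_finite N \<longleftrightarrow> stably_finite M"
  by (simp add: stably_finite_def transfer_simps cong: ball_cong)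

lemma separative_iff: "separative N \<longleftrightarrow> separative M"
  by (simp add: separative_def transfer_simps cong: ball_cong)

lemma unperforated_iff: "unperforated N \<longleftrightarrow> unperforated M"
  by (simp add: unperforated_def transfer_simps cong: ball_cong)

lemma archimedean_iff: "archimedean N \<longleftrightarrow> archimedean M"
  by (simp add: archimedean_def transfer_simps cong: ball_cong)

lemma o_ideal_vimage:
  assumes "o_ideal J N"
  shows "o_ideal {x \<in> carrier M. h x \<in> J} M"
proof -
  have J: "submonoid J N" "\<forall>x\<in>carrier N. \<forall>y\<in>J. x divides\<^bsub>N\<^esub> y \<longrightarrow> x \<in> J"
    using assms unfolding o_ideal_def by blast+
  interpret J: submonoid J N by (fact J(1))
  show ?thesis
    unfolding o_ideal_def
  proof (intro conjI ballI impI)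
    show "submonoid {x \<in> carrier M. h x \<in> J} M"
      by (rule submonoid.intro) (simp_all add: map_one map_mult[symmetric] subset_iff)
    fix x y assume x: "x \<in> carrier M" and y: "y \<in> {x \<in> carrier M. h x \<in> J}" "x divides\<^bsub>M\<^esub> y"
    then have "h x divides\<^bsub>N\<^esub> h y" by (simp add: map_divides)
    then show "x \<in> {x \<in> carrier M. h x \<in> J}"
      using x y J(2)[rule_format, of "h x" "h y"] by simp
  qed
qed

lemma iso_restrict:
  assumes "J \<subseteq> carrier N"
  shows "h \<in> iso (M\<lparr>carrier := {x \<in> carrier M. h x \<in> J}\<rparr>) (N\<lparr>carrier := J\<rparr>)"
proof -
  have "h ` {x \<in> carrier M. h x \<in> J} = J"
    using assms by (auto simp: image_carrier)
  moreover have "inj_on h {x \<in> carrier M. h x \<in> J}"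
    by (auto simp: inj_on_def map_eq_iff)
  moreover have "h \<in> hom (M\<lparr>carrier := {x \<in> carrier M. h x \<in> J}\<rparr>) (N\<lparr>carrier := J\<rparr>)"
    by (simp add: hom_def map_mult)
  ultimately show ?thesis
    by (simp add: iso_iff)
qed

end

lemma stably_finite_conical_imp_antisymmetric:
  assumes "comm_monoid M" "stably_finite M" "conical M"
  shows "antisymmetric M"
  unfolding antisymmetric_def
proof (intro ballI impI, elim conjE)
  interpret comm_monoid M by fact
  fix x y assume x: "x \<in> carrier M" "y \<in> carrier M" "x divides\<^bsub>M\<^esub> y" "y divides\<^bsub>M\<^esub> x"
  then obtain a b where a: "a \<in> carrier M" "b \<in> carrier M" "y = x \<otimes>\<^bsub>M\<^esub> a" "x = y \<otimes>\<^bsub>M\<^esub> b"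
    unfolding factor_def by (elim bexE)
  have "x \<otimes>\<^bsub>M\<^esub> (a \<otimes>\<^bsub>M\<^esub> b) = x"
    using m_assoc[OF x(1) a(1,2)] by (simp only: a(3)[symmetric] a(4)[symmetric])
  then have "a \<otimes>\<^bsub>M\<^esub> b = \<one>\<^bsub>M\<^esub>"
    using assms(2) x(1) a(1,2) by (simp add: stably_finite_def)
  then have "a = \<one>\<^bsub>M\<^esub>" using assms(3) a(1,2) unfolding conical_def by blast
  then show "x = y" using a(3) x(1) by simp
qed

subsection \<open>Normal forms in presented monoids\<close>

lemma generated_cong_add:
  assumes "(u, u') \<in> generated_cong R" "(v, v') \<in> generated_cong R"
  shows "(u + v, u' + v') \<in> generated_cong R"
  using generated_cong.trans[OF generated_cong.add[OF assms(1), of v]]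
    generated_cong.add[OF assms(2), of u'] by (simp add: add.commute)

lemma generated_cong_replicate:
  assumes "({#a#}, {#b, c#}) \<in> generated_cong R"
  shows "(replicate_mset n a, replicate_mset n b + replicate_mset n c) \<in> generated_cong R"
proof (induction n)
  case (Suc n)
  then show ?case using generated_cong_add[OF assms Suc.IH] by (simp add: ac_simps add_mset_commute)
qed (simp add: generated_cong.refl)

text \<open>
  Here \<open>good n v\<close> says that the value \<open>v\<close> has a normal form \<open>nf n v\<close> at stage \<open>n\<close>. Normal forms can be
  carried to later stages and added at a common stage, so by induction every word is congruent to the
  normal form of its value at some stage. Two words with equal values are then congruent to the same
  normal form. A single stage would not do: the generators \<open>x\<^sub>l\<close> form an infinite descending chain, and
  no fixed finite set of generators expresses all of them.
\<close>

lemma presented_monoid_iso: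
  fixes val :: "'g \<Rightarrow> 'b::comm_monoid_add" and nf :: "nat \<Rightarrow> 'b \<Rightarrow> 'g multiset"
  defines "eval \<equiv> \<lambda>u. \<Sum>g\<in>#u. val g"
  assumes rel: "\<And>u v. (u, v) \<in> R \<Longrightarrow> eval u = eval v"
    and zero: "good 0 0" "nf 0 0 = {#}"
    and gen: "\<And>g. \<exists>n. good n (val g) \<and> nf n (val g) = {#g#}"
    and up: "\<And>n v. good n v \<Longrightarrow> good (Suc n) v"
      "\<And>n v. good n v \<Longrightarrow> (nf n v, nf (Suc n) v) \<in> generated_cong R"
    and sum: "\<And>n v w. good n v \<Longrightarrow> good n w \<Longrightarrow> good n (v + w)"
      "\<And>n v w. good n v \<Longrightarrow> good n w \<Longrightarrow> (nf n v + nf n w, nf n (v + w)) \<in> generated_cong R"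
    and eval_nf: "\<And>n v. good n v \<Longrightarrow> eval (nf n v) = v"
  shows "comm_monoid (presented_monoid R) \<and>
    presented_monoid R \<cong> additive_monoid\<lparr>carrier := {v. \<exists>n. good n v}\<rparr>"
proof -
  let ?C = "generated_cong R"
  have eval_simps [simp]: "eval {#} = 0" "eval (add_mset g v) = val g + eval v"
    "eval (u + v) = eval u + eval v" for g u v
    by (simp_all add: eval_def)
  have sound: "eval u = eval v" if "(u, v) \<in> ?C" for u v
    using that by induction (simp_all add: rel)
  have later: "good (n + k) v \<and> (nf n v, nf (n + k) v) \<in> ?C" if "good n v" for n k v
  proof (induction k)
    case (Suc k)
    then have k: "good (n + k) v" "(nf n v, nf (n + k) v) \<in> ?C" by simp_all
    show ?case using up(1)[OF k(1)] generated_cong.trans[OF k(2) up(2)[OF k(1)]] by simp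
  qed (simp add: that generated_cong.refl)
  have normal: "\<exists>n. good n (eval u) \<and> (u, nf n (eval u)) \<in> ?C" for u
  proof (induction u)
    case empty
    show ?case using zero generated_cong.refl[of "{#}" R] by (intro exI[of _ 0]) simp
  next
    case (add g u)
    then obtain n where n: "good n (eval u)" "(u, nf n (eval u)) \<in> ?C" by blast
    obtain m where m: "good m (val g)" "nf m (val g) = {#g#}" using gen[of g] by blast
    have n': "good (n + m) (eval u)" "(u, nf (n + m) (eval u)) \<in> ?C"
      using later[OF n(1), of m] generated_cong.trans[OF n(2)] by simp_all
    have m': "good (n + m) (val g)" "({#g#}, nf (n + m) (val g)) \<in> ?C"
      using later[OF m(1), of n] m(2) by (simp_all add: add.commute)
    have "({#g#} + u, nf (n + m) (val g) + nf (n + m) (eval u)) \<in> ?C"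
      by (rule generated_cong_add[OF m'(2) n'(2)])
    then have "({#g#} + u, nf (n + m) (val g + eval u)) \<in> ?C"
      using sum(2)[OF m'(1) n'(1)] by (rule generated_cong.trans)
    then show ?case using sum(1)[OF m'(1) n'(1)] by (intro exI[of _ "n + m"]) simp
  qed
  have complete: "(u, v) \<in> ?C" if uv: "eval u = eval v" for u v
  proof -
    obtain n where n: "good n (eval u)" "(u, nf n (eval u)) \<in> ?C" using normal[of u] by blast
    obtain m where m: "good m (eval u)" "(v, nf m (eval u)) \<in> ?C" using normal[of v] uv by auto
    have "(u, nf (n + m) (eval u)) \<in> ?C"
      using later[OF n(1), of m] generated_cong.trans[OF n(2)] by simp
    moreover have "(v, nf (n + m) (eval u)) \<in> ?C"
      using later[OF m(1), of n] generated_cong.trans[OF m(2)] by (simp add: add.commute)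
    ultimately show ?thesis by (rule generated_cong.trans[OF _ generated_cong.sym])
  qed
  interpret comm_monoid "additive_monoid :: 'g multiset monoid"
    by (rule comm_monoidI) (simp_all add: additive_monoid_def ac_simps)
  have range: "range eval = {v. \<exists>n. good n v}"
  proof
    show "range eval \<subseteq> {v. \<exists>n. good n v}"
    proof (intro subsetI, elim rangeE)
      fix v u assume "v = eval u"
      then show "v \<in> {v. \<exists>n. good n v}" using normal[of u] by auto
    qed
    show "{v. \<exists>n. good n v} \<subseteq> range eval"
    proof (intro subsetI, elim CollectE exE)
      fix v n assume "good n v"
      then show "v \<in> range eval" by (intro range_eqI[of _ _ "nf n v"]) (simp only: eval_nf)
    qed
  qed
  interpret kernel_quotient additive_monoid "additive_monoid\<lparr>carrier := {v. \<exists>n. good n v}\<rparr>" eval ?C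
  proof
    show "eval \<in> hom additive_monoid (additive_monoid\<lparr>carrier := {v. \<exists>n. good n v}\<rparr>)"
      using normal by (simp add: hom_def additive_monoid_def) blast
    show "eval ` carrier additive_monoid = carrier (additive_monoid\<lparr>carrier := {v. \<exists>n. good n v}\<rparr>)"
      using range by (simp add: additive_monoid_def)
    show "(u, v) \<in> ?C \<longleftrightarrow> u \<in> carrier additive_monoid \<and> v \<in> carrier additive_monoid \<and>
       eval u = eval v" for u v
      using sound[of u v] complete[of u v] by (auto simp: additive_monoid_def)
  qed
  show "comm_monoid (presented_monoid R) \<and>
    presented_monoid R \<cong> additive_monoid\<lparr>carrier := {v. \<exists>n. good n v}\<rparr>"
    unfolding presented_monoid_def using comm_monoid_quotient quotient_iso by (rule conjI)
qed

section \<open>A model of the quotient by finite supports\<close>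

text \<open>
  \<open>YZ i j\<close> is \<open>i y + j z\<close>. \<open>Xs n c\<close> is \<open>(n + 1) x\<^sub>0 + c y\<close> with a possibly negative \<open>c\<close>; it contains
  at least one \<open>x\<close>, so \<open>z\<close> counts as \<open>y\<close>.
\<close>

datatype bar = YZ nat nat | Xs nat int

instantiation bar :: comm_monoid_add
begin

definition zero_bar :: bar where "zero_bar = YZ 0 0"

fun plus_bar :: "bar \<Rightarrow> bar \<Rightarrow> bar" where
  "YZ i j + YZ k l = YZ (i + k) (j + l)"
| "YZ i j + Xs n c = Xs n (c + int i + int j)"
| "Xs n c + YZ i j = Xs n (c + int i + int j)"
| "Xs n c + Xs m d = Xs (Suc (n + m)) (c + d)"

instance
proof
  fix a b c :: bar
  show "a + b + c = a + (b + c)" by (cases a; cases b; cases c) simp_all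
  show "a + b = b + a" by (cases a; cases b) simp_all
  show "0 + a = a" by (cases a) (simp_all add: zero_bar_def)
qed

end

fun slope :: "bar \<Rightarrow> nat" where
  "slope (YZ i j) = 0"
| "slope (Xs n c) = Suc n"

text \<open>
  The affine function that a representing function \<open>g\<close> eventually agrees with; \<open>slope\<close> is its slope.
\<close>

fun growth :: "bar \<Rightarrow> nat \<Rightarrow> int" where
  "growth (YZ i j) k = int i + int j"
| "growth (Xs n c) k = int (Suc n) * int k + c"

lemma slope_add [simp]: "slope (a + b) = slope a + slope b"
  by (cases a; cases b) simp_all

lemma growth_add [simp]: "growth (a + b) k = growth a k + growth b k"
  by (cases a; cases b) (simp_all add: algebra_simps)

lemma growth_zero [simp]: "growth 0 k = 0"
  by (simp add: zero_bar_def)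

lemma slope_zero [simp]: "slope 0 = 0"
  by (simp add: zero_bar_def)

lemma growth_Suc: "growth a (Suc k) = growth a k + int (slope a)"
  by (cases a) (simp_all add: algebra_simps)

lemma eventually_growth_nonneg: "eventually (\<lambda>k. 0 \<le> growth a k) sequentially"
proof (cases a)
  case (Xs n c)
  have "0 \<le> growth a k" if "nat (- c) \<le> k" for k
  proof -
    have "- c \<le> int k" using that by simp
    also have "\<dots> \<le> int (Suc n) * int k" by (simp add: algebra_simps)
    finally show ?thesis by (simp add: Xs)
  qed
  then show ?thesis unfolding eventually_sequentially by blast
qed simp

lemma bar_conical: "a + b = 0 \<Longrightarrow> a = (0 :: bar) \<and> b = 0"
  by (cases a; cases b) (simp_all add: zero_bar_def)

lemma bar_stably_finite: "a + b = a \<Longrightarrow> b = (0 :: bar)"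
  by (cases a; cases b) (simp_all add: zero_bar_def)

lemma bar_separative: "a + a = b + b \<Longrightarrow> a = (b :: bar)"
  by (cases a; cases b) auto

definition has_refinement :: "'a::comm_monoid_add \<Rightarrow> 'a \<Rightarrow> 'a \<Rightarrow> 'a \<Rightarrow> bool" where
  "has_refinement a b c d \<longleftrightarrow> (\<exists>p q r s. a = p + q \<and> b = r + s \<and> c = p + r \<and> d = q + s)"

lemma has_refinement_swap: "has_refinement a b c d \<Longrightarrow> has_refinement b a c d" "has_refinement a b c d \<Longrightarrow> has_refinement a b d c"
  "has_refinement a b c d \<Longrightarrow> has_refinement c d a b"
proof -
  assume "has_refinement a b c d"
  then obtain p q r s where e: "a = p + q" "b = r + s" "c = p + r" "d = q + s"
    by (auto simp: has_refinement_def)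
  show "has_refinement b a c d" unfolding has_refinement_def e
    by (rule exI[of _ r], rule exI[of _ s], rule exI[of _ p], rule exI[of _ q]) (simp add: add.commute)
  show "has_refinement a b d c" unfolding has_refinement_def e
    by (rule exI[of _ q], rule exI[of _ p], rule exI[of _ s], rule exI[of _ r]) (simp add: add.commute)
  show "has_refinement c d a b" unfolding has_refinement_def e
    by (rule exI[of _ p], rule exI[of _ r], rule exI[of _ q], rule exI[of _ s]) simp
qed

text \<open>
  If \<open>a = c + w\<close> and \<open>c\<close> can be cancelled from \<open>a + b = c + d\<close>, then \<open>d = w + b\<close>. So comparable
  summands and this cancellation suffice for a refinement, one entry of which is zero. Together with
  the symmetries this covers all cases except sums of \<open>y\<close>s and \<open>z\<close>s alone.
\<close>

lemma has_refinement_if_difference: "a = c + w \<Longrightarrow> d = w + b \<Longrightarrow> has_refinement a b c d"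
  unfolding has_refinement_def
  by (rule exI[of _ c], rule exI[of _ w], rule exI[of _ 0], rule exI[of _ b]) simp

lemma bar_has_refinement_YZ_Xs:
  assumes "Xs n e + b = c + YZ i j"
  shows "has_refinement (Xs n e) b c (YZ i j)"
proof -
  have "Xs n e = YZ i j + Xs n (e - int i - int j)" by simp
  moreover have "c = Xs n (e - int i - int j) + b"
    using assms by (cases b; cases c) auto
  ultimately show ?thesis by (blast intro: has_refinement_if_difference has_refinement_swap(2))
qed

text \<open>
  Elements containing an \<open>x\<close> are linearly ordered, lexicographically by slope and offset, and they
  cancel among each other.
\<close>

lemma bar_has_refinement_Xs:
  assumes "Xs n1 c1 + Xs n2 c2 = Xs m1 d1 + Xs m2 d2" and "m1 < n1 \<or> m1 = n1 \<and> d1 \<le> c1"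
  shows "has_refinement (Xs n1 c1) (Xs n2 c2) (Xs m1 d1) (Xs m2 d2)"
proof -
  define w where "w = (if m1 < n1 then Xs (n1 - m1 - 1) (c1 - d1) else YZ (nat (c1 - d1)) 0)"
  have "Xs n1 c1 = Xs m1 d1 + w" "Xs m2 d2 = w + Xs n2 c2"
    using assms by (auto simp: w_def)
  then show ?thesis by (rule has_refinement_if_difference)
qed

lemma bar_refinement_YZ:
  assumes eq: "a + b = c + YZ i j"
  shows "has_refinement a b c (YZ i j)"
proof (cases "slope a = 0 \<and> slope b = 0")
  case True
  then obtain k l m n p q where e: "a = YZ k l" "b = YZ m n" "c = YZ p q"
    using eq by (cases a; cases b; cases c) auto
  show ?thesis
    unfolding has_refinement_def
    \<comment> \<open>Refinement in \<open>\<nat>\<close> for the coefficients of \<open>y\<close> and of \<open>z\<close> separately.\<close>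
    using eq by (intro exI[of _ "YZ (min k p) (min l q)"] exI[of _ "YZ (k - min k p) (l - min l q)"]
      exI[of _ "YZ (p - min k p) (q - min l q)"]
      exI[of _ "YZ (m - (p - min k p)) (n - (q - min l q))"]) (auto simp: e)
next
  case False
  then consider n e where "a = Xs n e" | n e where "b = Xs n e"
    by (cases a; cases b) auto
  then show ?thesis
  proof cases
    case 1
    then show ?thesis using eq bar_has_refinement_YZ_Xs by simp
  next
    case 2
    have "b + a = c + YZ i j" using eq by (simp add: add.commute)
    then have "has_refinement b a c (YZ i j)" unfolding 2 by (rule bar_has_refinement_YZ_Xs)
    then show ?thesis by (rule has_refinement_swap(1))
  qed
qed

lemma bar_refinement:
  assumes eq: "a + b = c + (d :: bar)"
  shows "has_refinement a b c d"
proof -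
  have eqs: "a + b = d + c" "c + d = a + b" "c + d = b + a"
    using eq by (simp_all add: add.commute)
  consider i j where "d = YZ i j" | i j where "c = YZ i j" | i j where "b = YZ i j"
    | i j where "a = YZ i j" | n1 c1 n2 c2 m1 d1 m2 d2 where
      "a = Xs n1 c1" "b = Xs n2 c2" "c = Xs m1 d1" "d = Xs m2 d2"
    by (cases a; cases b; cases c; cases d) blast+
  then show ?thesis
  proof cases
    case 1
    then show ?thesis using eq by (simp add: bar_refinement_YZ)
  next
    case 2
    then show ?thesis using eqs(1) by (intro has_refinement_swap(2)[of a b d c]) (simp add: bar_refinement_YZ)
  next
    case 3
    then show ?thesis using eqs(2) by (intro has_refinement_swap(3)[of c d a b]) (simp add: bar_refinement_YZ)
  next
    case 4
    then have "has_refinement c d b a" using eqs(3) by (simp add: bar_refinement_YZ)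
    then show ?thesis by (intro has_refinement_swap(3)[of c d a b] has_refinement_swap(2)[of c d b a])
  next
    case 5
    consider "m1 < n1 \<or> m1 = n1 \<and> d1 \<le> c1" | "n1 < m1 \<or> n1 = m1 \<and> c1 \<le> d1" by linarith
    then show ?thesis
    proof cases
      case 1
      then show ?thesis using eq 5 bar_has_refinement_Xs by simp
    next
      case 2
      then have "has_refinement c d a b" using eqs(2) unfolding 5 by (rule bar_has_refinement_Xs[rotated])
      then show ?thesis by (rule has_refinement_swap(3))
    qed
  qed
qed

text \<open>
  Every \<open>i y + j z\<close> lies below every element containing an \<open>x\<close>, because offsets may be negative. This
  is what breaks the archimedean property.
\<close>

lemma bar_le_simps:
  "(\<exists>w. YZ k l = YZ i j + w) \<longleftrightarrow> i \<le> k \<and> j \<le> l"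
  "\<exists>w. Xs n c = YZ i j + w"
  "\<nexists>w. YZ i j = Xs n c + w"
  "(\<exists>w. Xs m d = Xs n c + w) \<longleftrightarrow> n < m \<or> n = m \<and> c \<le> d"
proof -
  show "(\<exists>w. YZ k l = YZ i j + w) \<longleftrightarrow> i \<le> k \<and> j \<le> l"
  proof
    assume "\<exists>w. YZ k l = YZ i j + w"
    then obtain w where "YZ k l = YZ i j + w" ..
    then show "i \<le> k \<and> j \<le> l" by (cases w) auto
  next
    assume "i \<le> k \<and> j \<le> l"
    then show "\<exists>w. YZ k l = YZ i j + w" by (intro exI[of _ "YZ (k - i) (l - j)"]) simp
  qed
  show "\<exists>w. Xs n c = YZ i j + w" by (rule exI[of _ "Xs n (c - int i - int j)"]) simp
  show "\<nexists>w. YZ i j = Xs n c + w"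
  proof
    assume "\<exists>w. YZ i j = Xs n c + w"
    then obtain w where "YZ i j = Xs n c + w" ..
    then show False by (cases w) auto
  qed
  show "(\<exists>w. Xs m d = Xs n c + w) \<longleftrightarrow> n < m \<or> n = m \<and> c \<le> d"
  proof
    assume "\<exists>w. Xs m d = Xs n c + w"
    then obtain w where "Xs m d = Xs n c + w" ..
    then show "n < m \<or> n = m \<and> c \<le> d" by (cases w) auto
  next
    assume "n < m \<or> n = m \<and> c \<le> d"
    then show "\<exists>w. Xs m d = Xs n c + w"
      by (intro exI[of _ "if n < m then Xs (m - n - 1) (d - c) else YZ (nat (d - c)) 0"]) auto
  qed
qed

abbreviation nfold :: "nat \<Rightarrow> 'a::comm_monoid_add \<Rightarrow> 'a" where
  "nfold n x \<equiv> ((+) x ^^ n) 0"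

lemma nfold_YZ: "nfold n (YZ i j) = YZ (n * i) (n * j)"
  by (induction n) (simp_all add: zero_bar_def)

lemma nfold_Xs: "nfold (Suc n) (Xs a c) = Xs (n * Suc a + a) (int (Suc n) * c)"
  by (induction n) (simp_all add: zero_bar_def algebra_simps)

lemma bar_unperforated:
  assumes "0 < m" and le: "\<exists>w. nfold m b = nfold m a + w"
  shows "\<exists>w. b = a + (w :: bar)"
proof -
  obtain n where m: "m = Suc n" using assms(1) gr0_implies_Suc by blast
  show ?thesis
  proof (cases a; cases b)
    fix i j k l assume ab: "a = YZ i j" "b = YZ k l"
    then have "m * i \<le> m * k \<and> m * j \<le> m * l"
      using le unfolding ab nfold_YZ bar_le_simps by simp
    then show ?thesis using assms(1) unfolding ab bar_le_simps by simp
  next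
    fix i j n c assume "a = YZ i j" "b = Xs n c"
    then show ?thesis using bar_le_simps(2) by simp
  next
    fix i j k c assume ab: "a = Xs k c" "b = YZ i j"
    show ?thesis using le bar_le_simps(3) unfolding ab m nfold_Xs nfold_YZ by blast
  next
    fix k c l d assume ab: "a = Xs k c" "b = Xs l d"
    have *: "n * Suc k + k < n * Suc l + l \<or>
      n * Suc k + k = n * Suc l + l \<and> int (Suc n) * c \<le> int (Suc n) * d"
      using le unfolding ab m nfold_Xs bar_le_simps .
    have "n * Suc x + x < n * Suc y + y" if "x < y" for x y
      using that by (intro add_le_less_mono mult_le_mono2) auto
    from this[of k l] this[of l k] have "n * Suc l + l < n * Suc k + k" if "l < k"
      using that by blast
    moreover have "c \<le> d" if "int (Suc n) * c \<le> int (Suc n) * d"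
      using that by (rule mult_left_le_imp_le) simp
    ultimately have "k < l \<or> k = l \<and> c \<le> d"
      using * by (cases k l rule: linorder_cases) auto
    then show ?thesis unfolding ab bar_le_simps .
  qed
qed

section \<open>A model of eventually affine functions\<close>

definition stabilizes :: "nat \<Rightarrow> (nat \<Rightarrow> nat) \<times> bar \<Rightarrow> bool" where
  "stabilizes n v \<longleftrightarrow> (\<forall>k\<ge>n. int (fst v k) = growth (snd v) k)"

text \<open>
  In a pair \<open>(g, m)\<close> with \<open>slope m \<noteq> 0\<close>, \<open>m\<close> is determined by \<open>g\<close>; otherwise it also records how the eventual value of
  \<open>g\<close> divides into \<open>y\<close>s and \<open>z\<close>s, which \<open>g\<close> cannot see.
\<close>

definition germs :: "((nat \<Rightarrow> nat) \<times> bar) set" where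
  "germs = {v. \<exists>n. stabilizes n v}"

lemma germs_eventually: "v \<in> germs \<longleftrightarrow> eventually (\<lambda>k. int (fst v k) = growth (snd v) k) sequentially"
  by (simp add: germs_def stabilizes_def eventually_sequentially)

lemma germs_zero [simp]: "0 \<in> germs"
  by (simp add: germs_eventually)

lemma stabilizes_add: "stabilizes n v \<Longrightarrow> stabilizes n w \<Longrightarrow> stabilizes n (v + w)"
  by (simp add: stabilizes_def)

lemma germs_add [simp]: "v \<in> germs \<Longrightarrow> w \<in> germs \<Longrightarrow> v + w \<in> germs"
  unfolding germs_eventually by (auto elim: eventually_elim2)

lemma germs_le_iff:
  assumes v: "v \<in> germs" and w: "w \<in> germs"
  shows "(\<exists>u\<in>germs. w = v + u) \<longleftrightarrow> (\<forall>k. fst v k \<le> fst w k) \<and> (\<exists>m. snd w = snd v + m)"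
proof
  assume "(\<forall>k. fst v k \<le> fst w k) \<and> (\<exists>m. snd w = snd v + m)"
  then obtain m where le: "\<And>k. fst v k \<le> fst w k" and m: "snd w = snd v + m" by blast
  define u where "u = ((\<lambda>k. fst w k - fst v k), m)"
  have "w = v + u" using le m by (auto simp: u_def prod_eq_iff fun_eq_iff)
  moreover have "u \<in> germs"
    using v w unfolding germs_eventually
  proof eventually_elim
    case (elim k)
    then show ?case using le[of k] m by (simp add: u_def of_nat_diff)
  qed
  ultimately show "\<exists>u\<in>germs. w = v + u" by blast
qed auto

text \<open>
  At arguments where all the functions involved agree with their growth and the prescribed entries
  are nonnegative, the refinement of the second components dictates that of the values. Only finitely
  many arguments remain, and there the values are refined independently in \<open>\<nat>\<close>, starting from the
  minimum.
\<close>

lemma germs_refinement: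
  assumes v: "v1 \<in> germs" "v2 \<in> germs" "w1 \<in> germs" "w2 \<in> germs" and eq: "v1 + v2 = w1 + w2"
  shows "\<exists>u11\<in>germs. \<exists>u12\<in>germs. \<exists>u21\<in>germs. \<exists>u22\<in>germs.
    v1 = u11 + u12 \<and> v2 = u21 + u22 \<and> w1 = u11 + u21 \<and> w2 = u12 + u22"
proof -
  have "snd v1 + snd v2 = snd w1 + snd w2" using arg_cong[OF eq, of snd] by simp
  then have "has_refinement (snd v1) (snd v2) (snd w1) (snd w2)" by (rule bar_refinement)
  then obtain p q r s where bar: "snd v1 = p + q" "snd v2 = r + s" "snd w1 = p + r" "snd w2 = q + s"
    by (auto simp: has_refinement_def)
  define P where "P k \<longleftrightarrow> 0 \<le> growth p k \<and> 0 \<le> growth q k \<and> 0 \<le> growth r k \<and> 0 \<le> growth s k \<and>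
    int (fst v1 k) = growth (snd v1) k \<and> int (fst v2 k) = growth (snd v2) k \<and>
    int (fst w1 k) = growth (snd w1) k \<and> int (fst w2 k) = growth (snd w2) k" for k
  have P: "eventually P sequentially"
    unfolding P_def using v unfolding germs_eventually
    by (intro eventually_conj eventually_growth_nonneg)
  define f11 where "f11 k = (if P k then nat (growth p k) else min (fst v1 k) (fst w1 k))" for k
  define f12 where "f12 k = (if P k then nat (growth q k) else fst v1 k - f11 k)" for k
  define f21 where "f21 k = (if P k then nat (growth r k) else fst w1 k - f11 k)" for k
  define f22 where "f22 k = (if P k then nat (growth s k) else fst v2 k - f21 k)" for k
  have sum: "fst v1 k + fst v2 k = fst w1 k + fst w2 k" for k
    using arg_cong[OF eq, of "\<lambda>v. fst v k"] by simp
  have f: "fst v1 k = f11 k + f12 k \<and> fst v2 k = f21 k + f22 k \<and>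
    fst w1 k = f11 k + f21 k \<and> fst w2 k = f12 k + f22 k" for k
  proof (cases "P k")
    case True
    then show ?thesis
      unfolding f11_def f12_def f21_def f22_def
      by (simp add: P_def bar nat_add_distrib[symmetric]) linarith
  next
    case False
    then show ?thesis
      using sum[of k] unfolding f11_def f12_def f21_def f22_def by auto
  qed
  have mem: "(f11, p) \<in> germs" "(f12, q) \<in> germs" "(f21, r) \<in> germs" "(f22, s) \<in> germs"
    unfolding germs_eventually
    by (rule eventually_mono[OF P]; simp add: f11_def f12_def f21_def f22_def P_def)+
  have "v1 = (f11, p) + (f12, q)" "v2 = (f21, r) + (f22, s)"
    "w1 = (f11, p) + (f21, r)" "w2 = (f12, q) + (f22, s)"
    using f bar by (auto simp: prod_eq_iff fun_eq_iff)
  then show ?thesis using mem by blast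
qed

text \<open>
  A coincidence of the second components after adding \<open>i y + j z\<close> and \<open>k y + l z\<close> lifts to pairs. At
  large arguments \<open>a\<close> and \<open>b\<close> have to be constant; at the others \<open>a\<close> takes the values of \<open>w\<close> and \<open>b\<close>
  those of \<open>v\<close>, so that both sums become the sum of \<open>v\<close> and \<open>w\<close>.
\<close>

lemma germs_common_multiple:
  assumes v: "v \<in> germs" and w: "w \<in> germs" and eq: "snd v + YZ i j = snd w + YZ k l"
  shows "\<exists>a\<in>germs. \<exists>b\<in>germs. snd a = YZ i j \<and> snd b = YZ k l \<and> v + a = w + b"
proof -
  define P where "P n \<longleftrightarrow> int (fst v n) = growth (snd v) n \<and> int (fst w n) = growth (snd w) n" for n
  have P: "eventually P sequentially"
    unfolding P_def using v w unfolding germs_eventually by (intro eventually_conj)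
  define a where "a = ((\<lambda>n. if P n then i + j else fst w n), YZ i j)"
  define b where "b = ((\<lambda>n. if P n then k + l else fst v n), YZ k l)"
  have "fst v n + fst a n = fst w n + fst b n" for n
  proof (cases "P n")
    case True
    have "growth (snd v + YZ i j) n = growth (snd w + YZ k l) n" using eq by simp
    then show ?thesis using True by (simp add: a_def b_def P_def)
  qed (simp add: a_def b_def)
  then have "v + a = w + b" using eq by (auto simp: prod_eq_iff fun_eq_iff a_def b_def)
  moreover have "a \<in> germs" "b \<in> germs"
    unfolding germs_eventually a_def b_def by (rule eventually_mono[OF P]; simp)+
  ultimately show ?thesis by (intro bexI[of _ a] bexI[of _ b]) (auto simp: a_def b_def)
qed

abbreviation bar_monoid :: "bar monoid" where
  "bar_monoid \<equiv> additive_monoid"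

abbreviation germ_monoid :: "((nat \<Rightarrow> nat) \<times> bar) monoid" where
  "germ_monoid \<equiv> additive_monoid\<lparr>carrier := germs\<rparr>"

lemma additive_simps [simp]:
  "carrier additive_monoid = UNIV"
  "x \<otimes>\<^bsub>additive_monoid\<lparr>carrier := S\<rparr>\<^esub> y = x + y" "\<one>\<^bsub>additive_monoid\<lparr>carrier := S\<rparr>\<^esub> = 0"
  "x \<otimes>\<^bsub>additive_monoid\<^esub> y = x + y" "\<one>\<^bsub>additive_monoid\<^esub> = 0"
  by (simp_all add: additive_monoid_def)

lemma additive_pow [simp]:
  "x [^]\<^bsub>additive_monoid\<lparr>carrier := S\<rparr>\<^esub> n = nfold n x" "x [^]\<^bsub>additive_monoid\<^esub> n = nfold n x"
  by (induction n) (simp_all add: nat_pow_def add.commute)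

lemma comm_monoid_bar: "comm_monoid bar_monoid"
  by (rule comm_monoidI) (simp_all add: ac_simps)

lemma comm_monoid_germ: "comm_monoid germ_monoid"
  by (rule comm_monoidI) (simp_all add: ac_simps)

lemma fst_nfold: "fst (nfold n v) k = n * fst v k" for v :: "(nat \<Rightarrow> nat) \<times> 'b::comm_monoid_add"
  by (induction n) simp_all

lemma snd_nfold: "snd (nfold n v) = nfold n (snd v)" for v :: "'c::comm_monoid_add \<times> 'b::comm_monoid_add"
  by (induction n) simp_all

lemma nfold_germs: "v \<in> germs \<Longrightarrow> nfold n v \<in> germs"
  by (induction n) simp_all

lemma bar_properties:
  "refinement_monoid bar_monoid" "conical bar_monoid" "stably_finite bar_monoid"
  "separative bar_monoid" "unperforated bar_monoid"
proof -
  show "refinement_monoid bar_monoid"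
    unfolding refinement_monoid_def additive_simps
  proof (intro conjI comm_monoid_bar ballI impI)
    fix a b c d :: bar
    assume "a + b = c + d"
    then have "has_refinement a b c d" by (rule bar_refinement)
    then show "\<exists>p\<in>UNIV. \<exists>q\<in>UNIV. \<exists>r\<in>UNIV. \<exists>s\<in>UNIV. a = p + q \<and> b = r + s \<and> c = p + r \<and> d = q + s"
      unfolding has_refinement_def by blast
  qed
  show "conical bar_monoid"
    unfolding conical_def additive_simps using bar_conical by blast
  show "stably_finite bar_monoid"
    unfolding stably_finite_def additive_simps using bar_stably_finite by blast
  show "separative bar_monoid"
    unfolding separative_def additive_simps using bar_separative by blast
  show "unperforated bar_monoid"
    unfolding unperforated_def factor_def additive_simps additive_pow
  proof (intro allI impI ballI)
    fix m :: nat and a b :: bar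
    assume "1 \<le> m" "\<exists>c\<in>UNIV. nfold m b = nfold m a + c"
    then show "\<exists>c\<in>UNIV. b = a + c" using bar_unperforated[of m b a] by simp
  qed
qed

lemma bar_not_archimedean: "\<not> archimedean bar_monoid"
proof
  assume arch: "archimedean bar_monoid"
  have "YZ 1 0 [^]\<^bsub>bar_monoid\<^esub> n divides\<^bsub>bar_monoid\<^esub> Xs 0 0" for n :: nat
    using bar_le_simps(2) by (simp add: factor_def nfold_YZ)
  then have "YZ 1 0 \<in> Units bar_monoid"
    by (intro arch[unfolded archimedean_def, rule_format, of "YZ 1 0" "Xs 0 0"]) simp_all
  then obtain b where "b + YZ 1 0 = 0" by (auto simp: Units_def)
  then show False using bar_conical[of b "YZ 1 0"] by (simp add: zero_bar_def)
qed

lemma germ_properties: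
  "refinement_monoid germ_monoid" "conical germ_monoid" "stably_finite germ_monoid"
  "separative germ_monoid"
proof -
  show "refinement_monoid germ_monoid"
    unfolding refinement_monoid_def additive_simps
  proof (intro conjI comm_monoid_germ ballI impI)
    fix v1 v2 w1 w2
    assume "v1 \<in> carrier germ_monoid" "v2 \<in> carrier germ_monoid" "w1 \<in> carrier germ_monoid"
      "w2 \<in> carrier germ_monoid" and eq: "v1 + v2 = w1 + w2"
    then have v: "v1 \<in> germs" "v2 \<in> germs" "w1 \<in> germs" "w2 \<in> germs" by simp_all
    have carrier: "carrier germ_monoid = germs" by simp
    show "\<exists>u11\<in>carrier germ_monoid. \<exists>u12\<in>carrier germ_monoid. \<exists>u21\<in>carrier germ_monoid.
      \<exists>u22\<in>carrier germ_monoid. v1 = u11 + u12 \<and> v2 = u21 + u22 \<and> w1 = u11 + u21 \<and> w2 = u12 + u22"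
      unfolding carrier by (rule germs_refinement[OF v eq])
  qed
  have "v = 0 \<and> w = 0" if "v + w = 0" for v w :: "(nat \<Rightarrow> nat) \<times> bar"
  proof -
    have "snd v + snd w = 0" using arg_cong[OF that, of snd] by simp
    moreover have "fst v k = 0 \<and> fst w k = 0" for k using arg_cong[OF that, of "\<lambda>u. fst u k"] by simp
    ultimately show ?thesis using bar_conical[of "snd v" "snd w"] by (simp add: prod_eq_iff fun_eq_iff)
  qed
  then show "conical germ_monoid" unfolding conical_def additive_simps by blast
  have "w = 0" if "v + w = v" for v w :: "(nat \<Rightarrow> nat) \<times> bar"
  proof -
    have "snd v + snd w = snd v" using arg_cong[OF that, of snd] by simp
    moreover have "fst w k = 0" for k using arg_cong[OF that, of "\<lambda>u. fst u k"] by simp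
    ultimately show ?thesis using bar_stably_finite[of "snd v" "snd w"] by (simp add: prod_eq_iff fun_eq_iff)
  qed
  then show "stably_finite germ_monoid" unfolding stably_finite_def additive_simps by blast
  have "v = w" if "v + v = w + w" for v w :: "(nat \<Rightarrow> nat) \<times> bar"
  proof -
    have "snd v + snd v = snd w + snd w" using arg_cong[OF that, of snd] by simp
    moreover have "fst v k = fst w k" for k using arg_cong[OF that, of "\<lambda>u. fst u k"] by simp
    ultimately show ?thesis using bar_separative[of "snd v" "snd w"] by (simp add: prod_eq_iff fun_eq_iff)
  qed
  then show "separative germ_monoid" unfolding separative_def additive_simps by blast
qed

lemma germ_unperforated: "unperforated germ_monoid"
  unfolding unperforated_def factor_def
proof (intro allI impI ballI)
  fix m :: nat and v w assume m: "1 \<le> m" and vw: "v \<in> carrier germ_monoid" "w \<in> carrier germ_monoid"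
    and "\<exists>c\<in>carrier germ_monoid. w [^]\<^bsub>germ_monoid\<^esub> m = v [^]\<^bsub>germ_monoid\<^esub> m \<otimes>\<^bsub>germ_monoid\<^esub> c"
  then have "\<exists>c\<in>germs. nfold m w = nfold m v + c" by simp
  then have le: "\<forall>k. m * fst v k \<le> m * fst w k" "\<exists>c. nfold m (snd w) = nfold m (snd v) + c"
    using vw germs_le_iff[of "nfold m v" "nfold m w"] by (simp_all add: nfold_germs fst_nfold snd_nfold)
  have "\<forall>k. fst v k \<le> fst w k" using le(1) m by simp
  moreover have "\<exists>c. snd w = snd v + c" using le(2) m bar_unperforated[of m] by simp
  ultimately have "\<exists>c\<in>germs. w = v + c" using vw germs_le_iff[of v w] by simp
  then show "\<exists>c\<in>carrier germ_monoid. w = v \<otimes>\<^bsub>germ_monoid\<^esub> c" by simp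
qed

lemma germ_archimedean: "archimedean germ_monoid"
  unfolding archimedean_def factor_def
proof (intro ballI impI)
  fix v w assume vw: "v \<in> carrier germ_monoid" "w \<in> carrier germ_monoid"
    and le: "\<forall>n\<ge>1. \<exists>c\<in>carrier germ_monoid. w = v [^]\<^bsub>germ_monoid\<^esub> (n::nat) \<otimes>\<^bsub>germ_monoid\<^esub> c"
  have bound: "n * fst v k \<le> fst w k" if "1 \<le> n" for n k
  proof -
    have "\<exists>c\<in>germs. w = nfold n v + c" using le[rule_format, OF that] by simp
    then show ?thesis
      using vw germs_le_iff[of "nfold n v" w] by (simp add: nfold_germs fst_nfold)
  qed
  have zero: "fst v k = 0" for k
  proof (rule ccontr)
    assume "fst v k \<noteq> 0"
    \<comment> \<open>A multiple of \<open>v\<close> by more than \<open>fst w k\<close> exceeds \<open>w\<close> at \<open>k\<close>.\<close>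
    then have "Suc (fst w k) * 1 \<le> Suc (fst w k) * fst v k" by (intro mult_le_mono2) simp
    then show False using bound[of "Suc (fst w k)" k] by simp
  qed
  obtain n where stable: "stabilizes n v" using vw by (auto simp: germs_def)
  have n: "growth (snd v) k = 0" if "n \<le> k" for k
  proof -
    have "int (fst v k) = growth (snd v) k" using stable that unfolding stabilizes_def by blast
    then show ?thesis using zero[of k] by simp
  qed
  have "snd v = 0"
  proof (cases "snd v")
    case (YZ i j)
    then show ?thesis using n[of n] by (simp add: zero_bar_def)
  next
    case (Xs a c)
    then show ?thesis using n[of n] n[of "Suc n"] growth_Suc[of "snd v" n] by simp
  qed
  then have "v = 0" using zero by (simp add: prod_eq_iff fun_eq_iff)
  then show "v \<in> Units germ_monoid"
    unfolding Units_def by (intro CollectI conjI bexI[of _ 0]) simp_all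
qed

section \<open>The presented monoids and their models\<close>

lemma replicate_mset_add: "replicate_mset (m + n) x = replicate_mset m x + replicate_mset n x"
  by (induction m) simp_all

lemma sum_mset_replicate_nfold: "sum_mset (replicate_mset n a) = nfold n a"
  by (induction n) simp_all

text \<open>
  One \<open>x\<close> converts any number of \<open>z\<close>s into \<open>y\<close>s, one after the other.
\<close>

lemma generated_cong_exchange:
  assumes "({#x, z#}, {#x, y#}) \<in> generated_cong R"
  shows "(replicate_mset (Suc n) x + replicate_mset j z, replicate_mset (Suc n) x + replicate_mset j y)
    \<in> generated_cong R"
proof (induction j)
  case (Suc j)
  let ?x = "replicate_mset (Suc n) x"
  let ?rest = "replicate_mset n x + replicate_mset j z"
  have "({#x, z#} + ?rest, {#x, y#} + ?rest) \<in> generated_cong R"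
    using assms by (rule generated_cong.add)
  moreover have "((?x + replicate_mset j z) + {#y#}, (?x + replicate_mset j y) + {#y#}) \<in> generated_cong R"
    using Suc.IH by (rule generated_cong.add)
  moreover have "{#x, z#} + ?rest = ?x + replicate_mset (Suc j) z"
    "{#x, y#} + ?rest = (?x + replicate_mset j z) + {#y#}"
    "(?x + replicate_mset j y) + {#y#} = ?x + replicate_mset (Suc j) y"
    by (rule multiset_eqI, simp)+
  ultimately show ?case by (simp only:) (rule generated_cong.trans)
qed (simp add: generated_cong.refl)

fun bar_val :: "gen_bar \<Rightarrow> bar" where
  "bar_val (BX l) = Xs 0 (- int l)"
| "bar_val BY = YZ 1 0"
| "bar_val BZ = YZ 0 1"

text \<open>
  At stage \<open>N\<close> all \<open>x\<close>s are written as \<open>x\<^sub>N\<close>, each of which is \<open>N\<close> copies of \<open>y\<close> short of \<open>x\<^sub>0\<close>. The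
  number of \<open>y\<close>s to be added is therefore the growth at \<open>N\<close>, and this is why that number must be
  nonnegative for the normal form to represent the element.
\<close>

fun bar_nf :: "nat \<Rightarrow> bar \<Rightarrow> gen_bar multiset" where
  "bar_nf N (YZ i j) = replicate_mset i BY + replicate_mset j BZ"
| "bar_nf N (Xs n c) =
    replicate_mset (Suc n) (BX N) + replicate_mset (nat (growth (Xs n c) N)) BY"

lemma rels_bar_cong:
  "({#BX 0, BY#}, {#BX 0, BZ#}) \<in> generated_cong rels_bar"
  "({#BX l#}, {#BX (Suc l), BY#}) \<in> generated_cong rels_bar"
  "({#BX l#}, {#BX (Suc l), BZ#}) \<in> generated_cong rels_bar"
  by (rule generated_cong.base; auto simp: rels_bar_def)+

text \<open>
  For \<open>l > 0\<close> both sides equal \<open>x\<^bsub>l-1\<^esub>\<close>; only \<open>l = 0\<close> needs the extra relation.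
\<close>

lemma BX_BZ_cong: "({#BX l, BZ#}, {#BX l, BY#}) \<in> generated_cong rels_bar"
proof (cases l)
  case 0
  then show ?thesis using rels_bar_cong(1) by (simp add: generated_cong.sym)
next
  case (Suc k)
  show ?thesis
    unfolding Suc using rels_bar_cong(3)[of k, THEN generated_cong.sym] rels_bar_cong(2)[of k]
    by (rule generated_cong.trans)
qed

lemma bar_nf_sum:
  assumes "0 \<le> growth v n" "0 \<le> growth w n"
  shows "(bar_nf n v + bar_nf n w, bar_nf n (v + w)) \<in> generated_cong rels_bar"
proof -
  have mixed: "(bar_nf n (YZ i j) + bar_nf n (Xs m c), bar_nf n (YZ i j + Xs m c)) \<in> generated_cong rels_bar"
    if "0 \<le> growth (Xs m c) n" for i j m c
  proof -
    let ?g = "nat (growth (Xs m c) n)"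
    have g: "nat (growth (Xs m (c + int i + int j)) n) = i + j + ?g"
      using that by simp
    have "bar_nf n (YZ i j) + bar_nf n (Xs m c) =
        (replicate_mset (Suc m) (BX n) + replicate_mset j BZ) + (replicate_mset i BY + replicate_mset ?g BY)"
      by (simp only: bar_nf.simps ac_simps)
    moreover have "bar_nf n (YZ i j + Xs m c) =
        (replicate_mset (Suc m) (BX n) + replicate_mset j BY) + (replicate_mset i BY + replicate_mset ?g BY)"
      unfolding plus_bar.simps bar_nf.simps g replicate_mset_add by (simp only: ac_simps)
    ultimately show ?thesis
      by (simp only: generated_cong.add[OF generated_cong_exchange[OF BX_BZ_cong]])
  qed
  show ?thesis
  proof (cases v; cases w)
    fix i j k l assume vw: "v = YZ i j" "w = YZ k l"
    show ?thesis unfolding vw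
      by (simp add: replicate_mset_add ac_simps generated_cong.refl)
  next
    fix i j m c assume vw: "v = YZ i j" "w = Xs m c"
    then show ?thesis using mixed[of m c i j] assms(2) by (simp only:)
  next
    fix i j m c assume vw: "v = Xs m c" "w = YZ i j"
    then show ?thesis using mixed[of m c i j] assms(1)
      by (simp only: add.commute[of "Xs m c"] add.commute[of "bar_nf n (Xs m c)"])
  next
    fix m c m' c' assume vw: "v = Xs m c" "w = Xs m' c'"
    have "nat (growth (v + w) n) = nat (growth v n) + nat (growth w n)"
      using assms by (simp add: nat_add_distrib)
    moreover have "Suc (Suc (m + m')) = Suc m + Suc m'" by simp
    ultimately have "bar_nf n (v + w) = bar_nf n v + bar_nf n w"
      unfolding vw plus_bar.simps bar_nf.simps
      by (simp only: replicate_mset_add ac_simps)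
    then show ?thesis by (simp add: generated_cong.refl)
  qed
qed

lemma MM_bar_iso: "comm_monoid MM_bar" "MM_bar \<cong> bar_monoid"
proof -
  let ?good = "\<lambda>n v. 0 \<le> growth v n"
  have "comm_monoid MM_bar \<and> MM_bar \<cong> additive_monoid\<lparr>carrier := {v. \<exists>n. ?good n v}\<rparr>"
    unfolding MM_bar_def
  proof (rule presented_monoid_iso[where val = bar_val and nf = bar_nf and good = ?good])
    show "(\<Sum>g\<in>#u. bar_val g) = (\<Sum>g\<in>#v. bar_val g)" if "(u, v) \<in> rels_bar" for u v
      using that by (auto simp: rels_bar_def)
    show "\<exists>n. 0 \<le> growth (bar_val g) n \<and> bar_nf n (bar_val g) = {#g#}" for g
    proof (cases g)
      case (BX l)
      then show ?thesis by (intro exI[of _ l]) simp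
    qed simp_all
    show good_Suc: "0 \<le> growth v (Suc n)" if "0 \<le> growth v n" for n v
      using that by (simp add: growth_Suc)
    show "(bar_nf n v, bar_nf (Suc n) v) \<in> generated_cong rels_bar" if "0 \<le> growth v n" for n v
    proof (cases v)
      case (YZ i j)
      then show ?thesis by (simp add: generated_cong.refl)
    next
      case (Xs m c)
      let ?g = "nat (growth v n)"
      have "nat (growth v (Suc n)) = Suc m + ?g"
        using that unfolding growth_Suc by (simp add: Xs)
      moreover have "(replicate_mset (Suc m) (BX n) + replicate_mset ?g BY,
          replicate_mset (Suc m) (BX (Suc n)) + replicate_mset (Suc m) BY + replicate_mset ?g BY)
          \<in> generated_cong rels_bar"
        by (rule generated_cong.add[OF generated_cong_replicate[OF rels_bar_cong(2)]])
      ultimately show ?thesis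
        by (simp only: Xs bar_nf.simps replicate_mset_add ac_simps)
    qed
    show "(\<Sum>g\<in>#bar_nf n v. bar_val g) = v" if "0 \<le> growth v n" for n v
      using that
      by (cases v) (simp_all add: sum_mset_replicate_nfold nfold_YZ nfold_Xs algebra_simps
          del: replicate_mset_Suc funpow.simps)
  qed (simp_all add: zero_bar_def bar_nf_sum)
  moreover have "\<exists>n. ?good n v" for v
    using eventually_growth_nonneg[of v] unfolding eventually_sequentially by blast
  then have "{v. \<exists>n. ?good n v} = UNIV" by blast
  moreover have "additive_monoid\<lparr>carrier := UNIV\<rparr> = bar_monoid" by (simp add: additive_monoid_def)
  ultimately show "comm_monoid MM_bar" "MM_bar \<cong> bar_monoid" by simp_all
qed

text \<open>
  \<open>GA l\<close> stands for \<open>a\<^bsub>l+1\<^esub>\<close>, which gives the indicator of \<open>{l}\<close>: this is the difference between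
  the indicators of \<open>{l, l + 1, \<dots>}\<close> and \<open>{l + 1, l + 2, \<dots>}\<close>.
\<close>

fun germ_val :: "gen \<Rightarrow> (nat \<Rightarrow> nat) \<times> bar" where
  "germ_val (GX l) = (\<lambda>k. k - l, Xs 0 (- int l))"
| "germ_val (GY l) = (\<lambda>k. if l \<le> k then 1 else 0, YZ 1 0)"
| "germ_val (GZ l) = (\<lambda>k. if l \<le> k then 1 else 0, YZ 0 1)"
| "germ_val (GA l) = (\<lambda>k. if k = l then 1 else 0, 0)"

text \<open>
  The normal form at stage \<open>n\<close> has a tail, which produces the values at the arguments \<open>k < n\<close>, and a
  head in \<open>x\<^sub>n, y\<^sub>n, z\<^sub>n\<close>, which vanish there. The argument \<open>c\<close> is the value at \<open>n\<close>; as \<open>x\<^sub>n\<close> vanishes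
  at \<open>n\<close> too, it is the number of \<open>y\<^sub>n\<close> in a head with some \<open>x\<^sub>n\<close>.
\<close>

fun germ_head :: "nat \<Rightarrow> nat \<Rightarrow> bar \<Rightarrow> gen multiset" where
  "germ_head n c (YZ i j) = replicate_mset i (GY n) + replicate_mset j (GZ n)"
| "germ_head n c (Xs m d) = replicate_mset (Suc m) (GX n) + replicate_mset c (GY n)"

definition germ_tail :: "nat \<Rightarrow> (nat \<Rightarrow> nat) \<Rightarrow> gen multiset" where
  "germ_tail n g = (\<Sum>k<n. replicate_mset (g k) (GA k))"

definition germ_nf :: "nat \<Rightarrow> (nat \<Rightarrow> nat) \<times> bar \<Rightarrow> gen multiset" where
  "germ_nf n v = germ_head n (fst v n) (snd v) + germ_tail n (fst v)"

lemma germ_tail_Suc: "germ_tail (Suc n) g = germ_tail n g + replicate_mset (g n) (GA n)"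
  by (simp add: germ_tail_def)

lemma germ_tail_add: "germ_tail n (f + g) = germ_tail n f + germ_tail n g"
  by (simp add: germ_tail_def replicate_mset_add sum.distrib)

lemma germ_tail_zero: "(\<And>k. k < n \<Longrightarrow> g k = 0) \<Longrightarrow> germ_tail n g = {#}"
  by (simp add: germ_tail_def)

lemma rels_cong:
  "({#GX 0, GY 0#}, {#GX 0, GZ 0#}) \<in> generated_cong rels"
  "({#GY l#}, {#GY (Suc l), GA l#}) \<in> generated_cong rels"
  "({#GZ l#}, {#GZ (Suc l), GA l#}) \<in> generated_cong rels"
  "({#GX l#}, {#GX (Suc l), GY (Suc l)#}) \<in> generated_cong rels"
  "({#GX l#}, {#GX (Suc l), GZ (Suc l)#}) \<in> generated_cong rels"
  by (rule generated_cong.base; auto simp: rels_def)+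

lemma GX_GZ_cong: "({#GX l, GZ l#}, {#GX l, GY l#}) \<in> generated_cong rels"
proof (cases l)
  case 0
  then show ?thesis using rels_cong(1) by (simp add: generated_cong.sym)
next
  case (Suc k)
  show ?thesis
    unfolding Suc using rels_cong(5)[of k, THEN generated_cong.sym] rels_cong(4)[of k]
    by (rule generated_cong.trans)
qed

text \<open>
  Passing to the next stage turns each \<open>y\<^sub>n\<close> or \<open>z\<^sub>n\<close> into its successor and one \<open>a\<^bsub>n+1\<^esub>\<close>, so that the tail
  grows by the value at \<open>n\<close>, and each \<open>x\<^sub>n\<close> into \<open>x\<^bsub>n+1\<^esub>\<close> and \<open>y\<^bsub>n+1\<^esub>\<close>, so that the number of \<open>y\<close>s
  grows by the slope.
\<close>

lemma germ_nf_Suc: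
  assumes "stabilizes n v"
  shows "(germ_nf n v, germ_nf (Suc n) v) \<in> generated_cong rels"
proof (cases "snd v")
  case (YZ i j)
  have "int (fst v n) = int i + int j" using assms by (simp add: stabilizes_def YZ)
  then have "fst v n = i + j" by simp
  then have "germ_nf (Suc n) v = ((replicate_mset i (GY (Suc n)) + replicate_mset i (GA n)) +
      (replicate_mset j (GZ (Suc n)) + replicate_mset j (GA n))) + germ_tail n (fst v)"
    unfolding germ_nf_def YZ germ_head.simps germ_tail_Suc
    by (simp only: replicate_mset_add ac_simps)
  moreover have "germ_nf n v =
      (replicate_mset i (GY n) + replicate_mset j (GZ n)) + germ_tail n (fst v)"
    by (simp only: germ_nf_def YZ germ_head.simps)
  ultimately show ?thesis
    by (simp only: generated_cong.add generated_cong_add generated_cong_replicate rels_cong)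
next
  case (Xs m c)
  have "int (fst v n) = growth (snd v) n" "int (fst v (Suc n)) = growth (snd v) (Suc n)"
    using assms by (simp_all add: stabilizes_def)
  then have "int (fst v (Suc n)) = int (fst v n) + int (Suc m)"
    by (simp only: growth_Suc Xs slope.simps)
  then have "fst v (Suc n) = Suc m + fst v n" by linarith
  then have "germ_nf (Suc n) v = ((replicate_mset (Suc m) (GX (Suc n)) + replicate_mset (Suc m) (GY (Suc n))) +
      (replicate_mset (fst v n) (GY (Suc n)) + replicate_mset (fst v n) (GA n))) + germ_tail n (fst v)"
    unfolding germ_nf_def Xs germ_head.simps germ_tail_Suc
    by (simp only: replicate_mset_add ac_simps)
  moreover have "germ_nf n v =
      (replicate_mset (Suc m) (GX n) + replicate_mset (fst v n) (GY n)) + germ_tail n (fst v)"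
    by (simp only: germ_nf_def Xs germ_head.simps)
  ultimately show ?thesis
    by (simp only: generated_cong.add generated_cong_add generated_cong_replicate rels_cong)
qed

lemma germ_head_sum:
  assumes "int c = growth a n" "int d = growth b n"
  shows "(germ_head n c a + germ_head n d b, germ_head n (c + d) (a + b)) \<in> generated_cong rels"
proof -
  have mixed: "(germ_head n c (YZ i j) + germ_head n d (Xs m e), germ_head n (c + d) (YZ i j + Xs m e))
      \<in> generated_cong rels" if "int c = growth (YZ i j) n" for i j m e c d
  proof -
    have c: "c = i + j" using that by simp
    have "germ_head n c (YZ i j) + germ_head n d (Xs m e) =
        (replicate_mset (Suc m) (GX n) + replicate_mset j (GZ n)) +
        (replicate_mset i (GY n) + replicate_mset d (GY n))"
      unfolding germ_head.simps by (simp only: ac_simps)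
    moreover have "germ_head n (c + d) (YZ i j + Xs m e) =
        (replicate_mset (Suc m) (GX n) + replicate_mset j (GY n)) +
        (replicate_mset i (GY n) + replicate_mset d (GY n))"
      unfolding plus_bar.simps germ_head.simps c replicate_mset_add by (simp only: ac_simps)
    ultimately show ?thesis
      by (simp only: generated_cong.add[OF generated_cong_exchange[OF GX_GZ_cong]])
  qed
  show ?thesis
  proof (cases a; cases b)
    fix i j k l assume ab: "a = YZ i j" "b = YZ k l"
    have "germ_head n (c + d) (a + b) = germ_head n c a + germ_head n d b"
      unfolding ab plus_bar.simps germ_head.simps replicate_mset_add by (simp only: ac_simps)
    then show ?thesis by (simp only: generated_cong.refl)
  next
    fix i j m e assume ab: "a = YZ i j" "b = Xs m e"
    then show ?thesis using mixed[of c i j d m e] assms(1) by (simp only:)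
  next
    fix i j m e assume ab: "a = Xs m e" "b = YZ i j"
    then show ?thesis using mixed[of d i j c m e] assms(2)
      by (simp only: add.commute[of "Xs m e"] add.commute[of "germ_head n c (Xs m e)"] add.commute[of c])
  next
    fix m e m' e' assume ab: "a = Xs m e" "b = Xs m' e'"
    have "Suc (Suc (m + m')) = Suc m + Suc m'" by simp
    then have "germ_head n (c + d) (a + b) = germ_head n c a + germ_head n d b"
      unfolding ab plus_bar.simps germ_head.simps by (simp only: replicate_mset_add ac_simps)
    then show ?thesis by (simp only: generated_cong.refl)
  qed
qed

lemma germ_nf_sum:
  assumes "stabilizes n v" "stabilizes n w"
  shows "(germ_nf n v + germ_nf n w, germ_nf n (v + w)) \<in> generated_cong rels"
proof -
  have "(germ_head n (fst v n) (snd v) + germ_head n (fst w n) (snd w),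
      germ_head n (fst v n + fst w n) (snd v + snd w)) \<in> generated_cong rels"
    using assms by (intro germ_head_sum) (simp_all add: stabilizes_def)
  then have "((germ_head n (fst v n) (snd v) + germ_head n (fst w n) (snd w)) + germ_tail n (fst v + fst w),
      germ_head n (fst v n + fst w n) (snd v + snd w) + germ_tail n (fst v + fst w)) \<in> generated_cong rels"
    by (rule generated_cong.add)
  moreover have "germ_nf n v + germ_nf n w =
      (germ_head n (fst v n) (snd v) + germ_head n (fst w n) (snd w)) + germ_tail n (fst v + fst w)"
    unfolding germ_nf_def germ_tail_add by (simp only: ac_simps)
  moreover have "germ_nf n (v + w) =
      germ_head n (fst v n + fst w n) (snd v + snd w) + germ_tail n (fst v + fst w)"
    by (simp add: germ_nf_def)
  ultimately show ?thesis by (simp only:)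
qed

lemma eval_germ_tail:
  "(\<Sum>g\<in>#germ_tail n f. germ_val g) = (\<lambda>k. if k < n then f k else 0, 0)"
proof (induction n)
  case 0
  show ?case by (simp add: germ_tail_def prod_eq_iff fun_eq_iff)
next
  case (Suc n)
  have "nfold m (\<lambda>k. if k = n then 1 else 0, 0) = (\<lambda>k. if k = n then m else 0, 0 :: bar)" for m :: nat
    by (induction m) (simp_all add: prod_eq_iff fun_eq_iff)
  then have "(\<Sum>g\<in>#germ_tail (Suc n) f. germ_val g) =
      (\<lambda>k. if k < n then f k else 0, 0) + (\<lambda>k. if k = n then f n else 0, 0)"
    by (simp add: germ_tail_Suc Suc.IH sum_mset_replicate_nfold del: funpow.simps)
  also have "\<dots> = (\<lambda>k. if k < Suc n then f k else 0, 0)"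
    by (simp add: plus_prod_def fun_eq_iff less_Suc_eq)
  finally show ?case .
qed

lemma eval_germ_nf:
  assumes "stabilizes n v"
  shows "(\<Sum>g\<in>#germ_nf n v. germ_val g) = v"
proof (rule prod_eqI)
  let ?e = "\<Sum>g\<in>#germ_head n (fst v n) (snd v). germ_val g"
  have split: "(\<Sum>g\<in>#germ_nf n v. germ_val g) = ?e + (\<lambda>k. if k < n then fst v k else 0, 0)"
    by (simp add: germ_nf_def eval_germ_tail)
  have v: "int (fst v k) = growth (snd v) k" if "n \<le> k" for k
    using assms that by (simp add: stabilizes_def)
  show "snd (\<Sum>g\<in>#germ_nf n v. germ_val g) = snd v"
    unfolding split using v[of n]
    by (cases "snd v") (simp_all add: sum_mset_replicate_nfold snd_nfold nfold_YZ nfold_Xs algebra_simps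
        del: replicate_mset_Suc funpow.simps)
  show "fst (\<Sum>g\<in>#germ_nf n v. germ_val g) = fst v"
  proof
    fix k
    have "fst ?e k = (if k < n then 0 else fst v k)"
    proof (cases "snd v")
      case (YZ i j)
      have "fst v k = i + j" if "n \<le> k" using v[OF that] unfolding YZ growth.simps by linarith
      then show ?thesis
        by (simp add: YZ sum_mset_replicate_nfold fst_nfold del: funpow.simps)
    next
      case (Xs m c)
      have "fst v k = Suc m * (k - n) + fst v n" if le: "n \<le> k"
      proof -
        obtain d where d: "k = n + d" using le_Suc_ex[OF le] by blast
        have "int (fst v k) - int (fst v n) = int (Suc m) * int k - int (Suc m) * int n"
          using v[OF le] v[of n] by (simp add: Xs)
        also have "\<dots> = int (Suc m * (k - n))"
          unfolding d by (simp add: algebra_simps)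
        finally have "int (fst v k) = int (Suc m * (k - n) + fst v n)" by linarith
        then show ?thesis by (simp only: of_nat_eq_iff)
      qed
      then show ?thesis
        by (simp add: Xs sum_mset_replicate_nfold fst_nfold del: funpow.simps replicate_mset_Suc)
    qed
    then show "fst (\<Sum>g\<in>#germ_nf n v. germ_val g) k = fst v k"
      unfolding split by simp
  qed
qed

lemma MM_iso: "comm_monoid MM" "MM \<cong> germ_monoid"
proof -
  have "comm_monoid MM \<and> MM \<cong> additive_monoid\<lparr>carrier := {v. \<exists>n. stabilizes n v}\<rparr>"
    unfolding MM_def
  proof (rule presented_monoid_iso[where val = germ_val and nf = germ_nf])
    show "(\<Sum>g\<in>#u. germ_val g) = (\<Sum>g\<in>#v. germ_val g)" if "(u, v) \<in> rels" for u v
      using that by (auto simp: rels_def prod_eq_iff fun_eq_iff zero_bar_def)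
    show "stabilizes 0 0" "germ_nf 0 0 = {#}"
      by (simp_all add: stabilizes_def germ_nf_def germ_tail_def zero_bar_def)
    show "\<exists>n. stabilizes n (germ_val g) \<and> germ_nf n (germ_val g) = {#g#}" for g
    proof (cases g)
      case (GA l)
      \<comment> \<open>The head at stage \<open>l\<close> does not contain \<open>a\<^bsub>l+1\<^esub>\<close>; the tail at stage \<open>l + 1\<close> does.\<close>
      then show ?thesis
        by (intro exI[of _ "Suc l"]) (simp add: stabilizes_def germ_nf_def germ_tail_Suc germ_tail_zero zero_bar_def)
    qed (intro exI[of _ "case g of GX l \<Rightarrow> l | GY l \<Rightarrow> l | GZ l \<Rightarrow> l"],
        simp add: stabilizes_def germ_nf_def germ_tail_zero)+
    show "stabilizes (Suc n) v" if "stabilizes n v" for n v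
      using that by (simp add: stabilizes_def)
  qed (simp_all add: germ_nf_Suc stabilizes_add germ_nf_sum eval_germ_nf)
  then show "comm_monoid MM" "MM \<cong> germ_monoid" by (simp_all add: germs_def)
qed

section \<open>The o-ideals\<close>

lemma o_idealI:
  assumes "J \<subseteq> carrier (additive_monoid\<lparr>carrier := S\<rparr>)" "0 \<in> J"
    and "\<And>x y. x \<in> S \<Longrightarrow> y \<in> S \<Longrightarrow> x + y \<in> J \<longleftrightarrow> x \<in> J \<and> y \<in> J"
  shows "o_ideal J (additive_monoid\<lparr>carrier := S\<rparr>)"
  unfolding o_ideal_def
proof (intro conjI ballI impI)
  show "submonoid J (additive_monoid\<lparr>carrier := S\<rparr>)"
    using assms by (intro submonoid.intro) (auto simp: subset_iff)
  fix x y assume "x \<in> carrier (additive_monoid\<lparr>carrier := S\<rparr>)" "y \<in> J"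
    "x divides\<^bsub>additive_monoid\<lparr>carrier := S\<rparr>\<^esub> y"
  then show "x \<in> J" using assms(3) by (auto simp: factor_def)
qed

definition germ_J1 :: "((nat \<Rightarrow> nat) \<times> bar) set" where
  "germ_J1 = {v \<in> germs. snd v = 0}"

definition germ_J2 :: "((nat \<Rightarrow> nat) \<times> bar) set" where
  "germ_J2 = {v \<in> germs. slope (snd v) = 0}"

definition bar_J2 :: "bar set" where
  "bar_J2 = {a. slope a = 0}"

lemma germ_J1_o_ideal: "o_ideal germ_J1 germ_monoid"
  by (rule o_idealI) (auto simp: germ_J1_def dest: bar_conical)

lemma germ_J2_o_ideal: "o_ideal germ_J2 germ_monoid"
  by (rule o_idealI) (auto simp: germ_J2_def)

lemma additive_monoid_carrier_UNIV: "additive_monoid\<lparr>carrier := UNIV\<rparr> = additive_monoid"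
  by (simp add: additive_monoid_def)

lemma bar_J2_o_ideal: "o_ideal bar_J2 bar_monoid"
  using o_idealI[of bar_J2 UNIV] by (simp add: additive_monoid_carrier_UNIV bar_J2_def)

lemma germ_J1_subset: "germ_J1 \<subset> germ_J2"
proof
  show "germ_J1 \<subseteq> germ_J2" by (auto simp: germ_J1_def germ_J2_def)
  have "(\<lambda>_. 1, YZ 1 0) \<in> germ_J2" by (simp add: germ_J2_def germs_eventually)
  moreover have "(\<lambda>_. 1, YZ 1 0) \<notin> germ_J1" by (simp add: germ_J1_def zero_bar_def)
  ultimately show "germ_J1 \<noteq> germ_J2" by blast
qed

lemma finite_support:
  assumes "v \<in> germ_J1"
  shows "finite {k. fst v k \<noteq> 0}"
proof -
  obtain n where n: "stabilizes n v" "snd v = 0" using assms by (auto simp: germ_J1_def germs_def)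
  have "k < n" if "fst v k \<noteq> 0" for k
  proof (rule ccontr)
    assume "\<not> k < n"
    then have "int (fst v k) = growth (snd v) k" using n(1) by (simp add: stabilizes_def)
    then show False using n(2) that by simp
  qed
  then have "{k. fst v k \<noteq> 0} \<subseteq> {..<n}" by auto
  then show ?thesis by (rule finite_subset) simp
qed

lemma germ_J1_iso: "additive_monoid\<lparr>carrier := germ_J1\<rparr> \<cong> Zplus_sum"
proof (rule is_isoI)
  let ?f = "\<lambda>v. Abs_poly_mapping (fst v) :: nat \<Rightarrow>\<^sub>0 nat"
  have lookup: "Poly_Mapping.lookup (?f v) = fst v" if "v \<in> germ_J1" for v
    using finite_support[OF that] by (simp add: Abs_poly_mapping_inverse)
  have add: "v + w \<in> germ_J1" if "v \<in> germ_J1" "w \<in> germ_J1" for v w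
    using that by (simp add: germ_J1_def)
  show "?f \<in> iso (additive_monoid\<lparr>carrier := germ_J1\<rparr>) Zplus_sum"
    unfolding iso_iff
  proof (intro conjI)
    show "?f \<in> hom (additive_monoid\<lparr>carrier := germ_J1\<rparr>) Zplus_sum"
    proof (rule homI)
      fix v w assume "v \<in> carrier (additive_monoid\<lparr>carrier := germ_J1\<rparr>)"
        "w \<in> carrier (additive_monoid\<lparr>carrier := germ_J1\<rparr>)"
      then have vw: "v \<in> germ_J1" "w \<in> germ_J1" by simp_all
      have "?f (v + w) = ?f v + ?f w"
      proof (rule poly_mapping_eqI)
        fix k
        show "Poly_Mapping.lookup (?f (v + w)) k = Poly_Mapping.lookup (?f v + ?f w) k"
          unfolding lookup_add lookup[OF add[OF vw]] lookup[OF vw(1)] lookup[OF vw(2)] by simp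
      qed
      then show "?f (v \<otimes>\<^bsub>additive_monoid\<lparr>carrier := germ_J1\<rparr>\<^esub> w) = ?f v \<otimes>\<^bsub>Zplus_sum\<^esub> ?f w"
        by (simp only: additive_simps)
    qed simp
    have "p \<in> ?f ` germ_J1" for p :: "nat \<Rightarrow>\<^sub>0 nat"
    proof
      show "p = ?f (Poly_Mapping.lookup p, 0)" by simp
      obtain n where "\<forall>k\<in>Poly_Mapping.keys p. k < n"
        using finite_nat_set_iff_bounded[of "Poly_Mapping.keys p"] by auto
      then have "stabilizes n (Poly_Mapping.lookup p, 0)"
        by (auto simp: stabilizes_def in_keys_iff dest: leD)
      then show "(Poly_Mapping.lookup p, 0) \<in> germ_J1" by (auto simp: germ_J1_def germs_def)
    qed
    then have "?f ` germ_J1 = UNIV" by (intro UNIV_eq_I[symmetric])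
    then show "?f ` carrier (additive_monoid\<lparr>carrier := germ_J1\<rparr>) = carrier Zplus_sum" by simp
    show "inj_on ?f (carrier (additive_monoid\<lparr>carrier := germ_J1\<rparr>))"
    proof (rule inj_onI)
      fix v w assume vw: "v \<in> carrier (additive_monoid\<lparr>carrier := germ_J1\<rparr>)"
        "w \<in> carrier (additive_monoid\<lparr>carrier := germ_J1\<rparr>)" and eq: "?f v = ?f w"
      have mem: "v \<in> germ_J1" "w \<in> germ_J1" using vw by simp_all
      have "fst v = fst w"
        using arg_cong[OF eq, of Poly_Mapping.lookup] unfolding lookup[OF mem(1)] lookup[OF mem(2)] .
      moreover have "snd v = snd w" using mem by (simp add: germ_J1_def)
      ultimately show "v = w" by (simp add: prod_eq_iff)
    qed
  qed
qed

fun yz_count :: "bar \<Rightarrow> nat \<times> nat" where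
  "yz_count (YZ i j) = (i, j)"
| "yz_count (Xs n c) = (0, 0)"

lemma yz_count_iso: "yz_count \<in> iso (additive_monoid\<lparr>carrier := bar_J2\<rparr>) (Zplus \<times>\<times> Zplus)"
proof -
  have YZ: "\<exists>i j. a = YZ i j" if "a \<in> bar_J2" for a
    using that by (cases a) (simp_all add: bar_J2_def)
  have "yz_count (a + b) = (fst (yz_count a) + fst (yz_count b), snd (yz_count a) + snd (yz_count b))"
    if "a \<in> bar_J2" "b \<in> bar_J2" for a b
    using YZ[OF that(1)] YZ[OF that(2)] by auto
  then have "yz_count \<in> hom (additive_monoid\<lparr>carrier := bar_J2\<rparr>) (Zplus \<times>\<times> Zplus)"
    by (intro homI) (simp_all add: DirProd_def split_beta)
  moreover have "(i, j) \<in> yz_count ` bar_J2" for i j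
    by (rule image_eqI[of _ _ "YZ i j"]) (simp_all add: bar_J2_def)
  then have "yz_count ` bar_J2 = UNIV" by auto
  moreover have "inj_on yz_count bar_J2"
  proof (rule inj_onI)
    fix a b assume "a \<in> bar_J2" "b \<in> bar_J2" "yz_count a = yz_count b"
    then show "a = b" using YZ[of a] YZ[of b] by auto
  qed
  ultimately show ?thesis by (simp add: iso_iff)
qed

text \<open>
  Elements of the same positive slope differ by a multiple of \<open>y\<close>; for slope 0 each element serves as
  the witness for the other.
\<close>

lemma bar_quotient_kernel:
  "slope x = slope y \<longleftrightarrow> (\<exists>a\<in>bar_J2. \<exists>b\<in>bar_J2. x + a = y + b)"
proof
  assume eq: "slope x = slope y"
  show "\<exists>a\<in>bar_J2. \<exists>b\<in>bar_J2. x + a = y + b"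
  proof (cases "slope x = 0")
    case True
    then show ?thesis using eq by (intro bexI[of _ y] bexI[of _ x]) (simp_all add: bar_J2_def add.commute)
  next
    case False
    then obtain n c d where "x = Xs n c" "y = Xs n d" using eq by (cases x; cases y) auto
    then show ?thesis
      by (intro bexI[of _ "YZ (nat (d - c)) 0"] bexI[of _ "YZ (nat (c - d)) 0"]) (simp_all add: bar_J2_def)
  qed
next
  assume "\<exists>a\<in>bar_J2. \<exists>b\<in>bar_J2. x + a = y + b"
  then obtain a b where ab: "slope a = 0" "slope b = 0" "x + a = y + b" by (auto simp: bar_J2_def)
  show "slope x = slope y" using arg_cong[OF ab(3), of slope] ab(1,2) by simp
qed

lemma germ_J1_quotient_kernel:
  assumes "v \<in> germs" "w \<in> germs"
  shows "snd v = snd w \<longleftrightarrow> (\<exists>a\<in>germ_J1. \<exists>b\<in>germ_J1. v + a = w + b)"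
proof
  assume "snd v = snd w"
  then have "snd v + YZ 0 0 = snd w + YZ 0 0" by simp
  then show "\<exists>a\<in>germ_J1. \<exists>b\<in>germ_J1. v + a = w + b"
    using germs_common_multiple[OF assms] unfolding germ_J1_def zero_bar_def by blast
next
  assume "\<exists>a\<in>germ_J1. \<exists>b\<in>germ_J1. v + a = w + b"
  then obtain a b where ab: "snd a = 0" "snd b = 0" "v + a = w + b" by (auto simp: germ_J1_def)
  show "snd v = snd w" using arg_cong[OF ab(3), of snd] ab(1,2) by simp
qed

text \<open>
  The witnesses for the second components have the form \<open>i y + j z\<close>, so they lift to pairs.
\<close>

lemma germ_J2_quotient_kernel:
  assumes "v \<in> germs" "w \<in> germs"
  shows "slope (snd v) = slope (snd w) \<longleftrightarrow> (\<exists>a\<in>germ_J2. \<exists>b\<in>germ_J2. v + a = w + b)"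
proof
  assume "slope (snd v) = slope (snd w)"
  then obtain p q where pq: "slope p = 0" "slope q = 0" "snd v + p = snd w + q"
    unfolding bar_quotient_kernel bar_J2_def by blast
  obtain i j k l where "p = YZ i j" "q = YZ k l" using pq(1,2) by (cases p; cases q) auto
  then obtain a b where "a \<in> germs" "b \<in> germs" "snd a = p" "snd b = q" "v + a = w + b"
    using germs_common_multiple[OF assms] pq(3) by blast
  then show "\<exists>a\<in>germ_J2. \<exists>b\<in>germ_J2. v + a = w + b"
    using pq(1,2) unfolding germ_J2_def by blast
next
  assume "\<exists>a\<in>germ_J2. \<exists>b\<in>germ_J2. v + a = w + b"
  then obtain a b where ab: "slope (snd a) = 0" "slope (snd b) = 0" "v + a = w + b"
    by (auto simp: germ_J2_def)
  show "slope (snd v) = slope (snd w)" using arg_cong[OF ab(3), of "\<lambda>u. slope (snd u)"] ab(1,2) by simp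
qed

lemma snd_image_germs: "snd ` germs = UNIV"
proof -
  have "a \<in> snd ` germs" for a
  proof
    show "a = snd (\<lambda>k. nat (growth a k), a)" by simp
    show "(\<lambda>k. nat (growth a k), a) \<in> germs"
      unfolding germs_eventually
      by (rule eventually_mono[OF eventually_growth_nonneg[of a]]) simp
  qed
  then show ?thesis by blast
qed

lemma range_slope: "range slope = UNIV"
proof -
  have "n \<in> range slope" for n
  proof (cases n)
    case 0
    then show ?thesis by (intro range_eqI[of _ _ 0]) simp
  next
    case (Suc m)
    then show ?thesis by (intro range_eqI[of _ _ "Xs m 0"]) simp
  qed
  then show ?thesis by blast
qed

lemma MM_bar_quotient:
  assumes h: "h \<in> iso MM_bar bar_monoid"
  shows "MM_bar //\<^sub>o {x \<in> carrier MM_bar. h x \<in> bar_J2} \<cong> Zplus"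
proof (rule o_ideal_quotient_iso(1)[OF MM_bar_iso(1) h, where f = slope])
  show "slope \<in> hom bar_monoid Zplus" by (rule homI) simp_all
  show "slope ` carrier bar_monoid = carrier Zplus" using range_slope by simp
qed (simp_all add: bar_quotient_kernel)

text \<open>
  Dividing out the functions of finite support leaves only the second component, which is why the
  quotient monoid is the first of these quotients.
\<close>

lemma MM_quotients:
  assumes h: "h \<in> iso MM germ_monoid"
  shows "bar_monoid \<cong> MM //\<^sub>o {x \<in> carrier MM. h x \<in> germ_J1}"
    and "MM //\<^sub>o {x \<in> carrier MM. h x \<in> germ_J2} \<cong> Zplus"
proof -
  show "bar_monoid \<cong> MM //\<^sub>o {x \<in> carrier MM. h x \<in> germ_J1}"
  proof (rule o_ideal_quotient_iso(2)[OF MM_iso(1) h, where f = snd])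
    show "snd \<in> hom germ_monoid bar_monoid" by (rule homI) simp_all
    show "snd ` carrier germ_monoid = carrier bar_monoid" using snd_image_germs by simp
    show "germ_J1 \<subseteq> carrier germ_monoid" by (auto simp: germ_J1_def)
  qed (simp add: germ_J1_quotient_kernel)
  show "MM //\<^sub>o {x \<in> carrier MM. h x \<in> germ_J2} \<cong> Zplus"
  proof (rule o_ideal_quotient_iso(1)[OF MM_iso(1) h, where f = "\<lambda>v. slope (snd v)"])
    show "(\<lambda>v. slope (snd v)) \<in> hom germ_monoid Zplus" by (rule homI) simp_all
    have "(\<lambda>v. slope (snd v)) ` germs = range slope"
      unfolding snd_image_germs[symmetric] image_image ..
    then show "(\<lambda>v. slope (snd v)) ` carrier germ_monoid = carrier Zplus" using range_slope by simp
    show "germ_J2 \<subseteq> carrier germ_monoid" by (auto simp: germ_J2_def)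
  qed (simp add: germ_J2_quotient_kernel)
qed

text \<open>
  Induced by the second projection, followed by counting the \<open>y\<close>s and the \<open>z\<close>s.
\<close>

lemma MM_subquotient:
  assumes h: "h \<in> iso MM germ_monoid"
  shows "(MM\<lparr>carrier := {x \<in> carrier MM. h x \<in> germ_J2}\<rparr>) //\<^sub>o {x \<in> carrier MM. h x \<in> germ_J1}
    \<cong> Zplus \<times>\<times> Zplus"
proof -
  interpret comm_monoid_iso MM germ_monoid h
    using h MM_iso(1) comm_monoid_germ by (intro comm_monoid_iso.intro comm_monoid_iso_axioms.intro)
  let ?J1 = "{x \<in> carrier MM. h x \<in> germ_J1}" and ?J2 = "{x \<in> carrier MM. h x \<in> germ_J2}"
  let ?M = "MM\<lparr>carrier := ?J2\<rparr>" and ?A = "additive_monoid\<lparr>carrier := germ_J2\<rparr>"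
  have sub: "submonoid ?J2 MM" using o_ideal_vimage[OF germ_J2_o_ideal] by (simp add: o_ideal_def)
  have M: "comm_monoid ?M" using sub by (rule M.submonoid_is_comm_monoid)
  have iso: "h \<in> iso ?M ?A"
    using iso_restrict[of germ_J2] by (simp add: germ_J2_def)
  have J1: "?J1 = {x \<in> carrier ?M. h x \<in> germ_J1}" using germ_J1_subset by auto
  have J2: "snd v \<in> bar_J2" if "v \<in> germ_J2" for v using that by (simp add: germ_J2_def bar_J2_def)
  have image: "snd ` germ_J2 = bar_J2"
  proof
    show "bar_J2 \<subseteq> snd ` germ_J2"
    proof
      fix a assume a: "a \<in> bar_J2"
      have "a \<in> snd ` germs" using snd_image_germs by simp
      then show "a \<in> snd ` germ_J2" using a by (auto simp: germ_J2_def bar_J2_def)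
    qed
  qed (use J2 in auto)
  show ?thesis
    unfolding J1
  proof (rule o_ideal_quotient_iso(1)[OF M iso, where f = "\<lambda>v. yz_count (snd v)"])
    have yz: "yz_count \<in> hom (additive_monoid\<lparr>carrier := bar_J2\<rparr>) (Zplus \<times>\<times> Zplus)"
      "yz_count ` bar_J2 = UNIV" "inj_on yz_count bar_J2"
      using yz_count_iso by (simp_all add: iso_iff)
    show "(\<lambda>v. yz_count (snd v)) \<in> hom ?A (Zplus \<times>\<times> Zplus)"
    proof (rule homI)
      fix v w assume "v \<in> carrier ?A" "w \<in> carrier ?A"
      then show "yz_count (snd (v \<otimes>\<^bsub>?A\<^esub> w)) = yz_count (snd v) \<otimes>\<^bsub>Zplus \<times>\<times> Zplus\<^esub> yz_count (snd w)"
        using hom_mult[OF yz(1), of "snd v" "snd w"] by (simp add: J2)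
    qed simp
    have "(\<lambda>v. yz_count (snd v)) ` germ_J2 = UNIV"
      unfolding yz(2)[symmetric] image[symmetric] image_image ..
    then show "(\<lambda>v. yz_count (snd v)) ` carrier ?A = carrier (Zplus \<times>\<times> Zplus)" by simp
    show "germ_J1 \<subseteq> carrier ?A" using germ_J1_subset by auto
    fix v w assume "v \<in> carrier ?A" "w \<in> carrier ?A"
    then have vw: "v \<in> germ_J2" "w \<in> germ_J2" by simp_all
    then have "v \<in> germs" "w \<in> germs" by (simp_all add: germ_J2_def)
    then show "yz_count (snd v) = yz_count (snd w) \<longleftrightarrow>
        (\<exists>a\<in>germ_J1. \<exists>b\<in>germ_J1. v \<otimes>\<^bsub>?A\<^esub> a = w \<otimes>\<^bsub>?A\<^esub> b)"
      using vw by (simp add: germ_J1_quotient_kernel[symmetric] inj_on_eq_iff[OF yz(3)] J2)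
  qed
qed

section \<open>Transfer to the presented monoids\<close>

lemma MM_bar_properties:
  "refinement_monoid MM_bar" "conical MM_bar" "stably_finite MM_bar" "antisymmetric MM_bar"
  "separative MM_bar" "unperforated MM_bar" "\<not> archimedean MM_bar"
proof -
  obtain h where h: "h \<in> iso MM_bar bar_monoid" using MM_bar_iso(2) by (auto simp: is_iso_def)
  interpret comm_monoid_iso MM_bar bar_monoid h
    using h MM_bar_iso(1) comm_monoid_bar by (intro comm_monoid_iso.intro comm_monoid_iso_axioms.intro)
  show "refinement_monoid MM_bar" using bar_properties(1) by (simp add: refinement_iff)
  show "conical MM_bar" using bar_properties(2) by (simp add: conical_iff)
  moreover show "stably_finite MM_bar" using bar_properties(3) by (simp add: stably_finite_iff)
  ultimately show "antisymmetric MM_bar"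
    by (intro stably_finite_conical_imp_antisymmetric[OF MM_bar_iso(1)])
  show "separative MM_bar" using bar_properties(4) by (simp add: separative_iff)
  show "unperforated MM_bar" using bar_properties(5) by (simp add: unperforated_iff)
  show "\<not> archimedean MM_bar" using bar_not_archimedean by (simp add: archimedean_iff)
qed

lemma MM_properties:
  "refinement_monoid MM" "conical MM" "stably_finite MM" "antisymmetric MM"
  "separative MM" "unperforated MM" "archimedean MM"
proof -
  obtain h where h: "h \<in> iso MM germ_monoid" using MM_iso(2) by (auto simp: is_iso_def)
  interpret comm_monoid_iso MM germ_monoid h
    using h MM_iso(1) comm_monoid_germ by (intro comm_monoid_iso.intro comm_monoid_iso_axioms.intro)
  show "refinement_monoid MM" using germ_properties(1) by (simp add: refinement_iff)
  show "conical MM" using germ_properties(2) by (simp add: conical_iff)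
  moreover show "stably_finite MM" using germ_properties(3) by (simp add: stably_finite_iff)
  ultimately show "antisymmetric MM"
    by (intro stably_finite_conical_imp_antisymmetric[OF MM_iso(1)])
  show "separative MM" using germ_properties(4) by (simp add: separative_iff)
  show "unperforated MM" using germ_unperforated by (simp add: unperforated_iff)
  show "archimedean MM" using germ_archimedean by (simp add: archimedean_iff)
qed

lemma iso_noncancellative:
  fixes M :: "'a monoid" and N :: "'b monoid"
  assumes "comm_monoid M" "comm_monoid N" "M \<cong> N"
    and "\<exists>x\<in>carrier N. \<exists>y\<in>carrier N. \<exists>z\<in>carrier N. x \<otimes>\<^bsub>N\<^esub> y = x \<otimes>\<^bsub>N\<^esub> z \<and> y \<noteq> z"
  shows "\<exists>x\<in>carrier M. \<exists>y\<in>carrier M. \<exists>z\<in>carrier M. x \<otimes>\<^bsub>M\<^esub> y = x \<otimes>\<^bsub>M\<^esub> z \<and> y \<noteq> z"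
proof -
  obtain h where h: "h \<in> iso M N" using assms(3) by (auto simp: is_iso_def)
  interpret comm_monoid_iso M N h
    using h assms(1,2) by (intro comm_monoid_iso.intro comm_monoid_iso_axioms.intro)
  show ?thesis using assms(4) by (simp add: transfer_simps cong: bex_cong)
qed

lemma MM_bar_noncancellative:
  "\<exists>x\<in>carrier MM_bar. \<exists>y\<in>carrier MM_bar. \<exists>z\<in>carrier MM_bar.
    x \<otimes>\<^bsub>MM_bar\<^esub> y = x \<otimes>\<^bsub>MM_bar\<^esub> z \<and> y \<noteq> z"
  by (rule iso_noncancellative[OF MM_bar_iso(1) comm_monoid_bar MM_bar_iso(2)],
      rule bexI[of _ "Xs 0 0"], rule bexI[of _ "YZ 1 0"], rule bexI[of _ "YZ 0 1"]) simp_all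

lemma MM_noncancellative:
  "\<exists>x\<in>carrier MM. \<exists>y\<in>carrier MM. \<exists>z\<in>carrier MM. x \<otimes>\<^bsub>MM\<^esub> y = x \<otimes>\<^bsub>MM\<^esub> z \<and> y \<noteq> z"
  by (rule iso_noncancellative[OF MM_iso(1) comm_monoid_germ MM_iso(2)],
      rule bexI[of _ "(\<lambda>k. k, Xs 0 0)"], rule bexI[of _ "(\<lambda>_. 1, YZ 1 0)"],
      rule bexI[of _ "(\<lambda>_. 1, YZ 0 1)"]) (simp_all add: germs_eventually)

lemma MM_bar_wild: "wild TYPE('i) TYPE('b) MM_bar"
proof -
  obtain x y z where "x \<in> carrier MM_bar" "y \<in> carrier MM_bar" "z \<in> carrier MM_bar"
    "x \<otimes>\<^bsub>MM_bar\<^esub> y = x \<otimes>\<^bsub>MM_bar\<^esub> z" "y \<noteq> z"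
    using MM_bar_noncancellative by (elim bexE conjE)
  then have "\<not> tame TYPE('i) TYPE('b) MM_bar"
    using tame_imp_cancellative[OF _ MM_bar_properties(2,3)] by blast
  then show ?thesis using MM_bar_properties(1) by (simp add: wild_def)
qed

lemma MM_wild: "wild TYPE('i) TYPE('b) MM"
proof -
  obtain x y z where "x \<in> carrier MM" "y \<in> carrier MM" "z \<in> carrier MM"
    "x \<otimes>\<^bsub>MM\<^esub> y = x \<otimes>\<^bsub>MM\<^esub> z" "y \<noteq> z"
    using MM_noncancellative by (elim bexE conjE)
  then have "\<not> tame TYPE('i) TYPE('b) MM"
    using tame_imp_cancellative[OF _ MM_properties(2,3)] by blast
  then show ?thesis using MM_properties(1) by (simp add: wild_def)
qed

lemma MM_o_ideals:
  "\<exists>J1 J2. o_ideal J1 MM \<and> o_ideal J2 MM \<and> J1 \<subset> J2 \<and>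
    MM\<lparr>carrier := J1\<rparr> \<cong> Zplus_sum \<and>
    (MM\<lparr>carrier := J2\<rparr>) //\<^sub>o J1 \<cong> Zplus \<times>\<times> Zplus \<and>
    MM //\<^sub>o J2 \<cong> Zplus \<and>
    MM_bar \<cong> MM //\<^sub>o J1"
proof -
  obtain h where h: "h \<in> iso MM germ_monoid" using MM_iso(2) by (auto simp: is_iso_def)
  interpret comm_monoid_iso MM germ_monoid h
    using h MM_iso(1) comm_monoid_germ by (intro comm_monoid_iso.intro comm_monoid_iso_axioms.intro)
  let ?J1 = "{x \<in> carrier MM. h x \<in> germ_J1}" and ?J2 = "{x \<in> carrier MM. h x \<in> germ_J2}"
  have "?J1 \<subset> ?J2"
  proof -
    obtain v where v: "v \<in> germ_J2" "v \<notin> germ_J1" using germ_J1_subset by blast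
    then have "v \<in> carrier germ_monoid" by (simp add: germ_J2_def)
    then obtain x where x: "v = h x" "x \<in> carrier MM"
      unfolding image_carrier by (elim imageE)
    then have "x \<in> ?J2" "x \<notin> ?J1" using v by simp_all
    moreover have "?J1 \<subseteq> ?J2" using germ_J1_subset by blast
    ultimately show ?thesis by (intro psubsetI) blast+
  qed
  moreover have "MM\<lparr>carrier := ?J1\<rparr> \<cong> Zplus_sum"
  proof -
    have "MM\<lparr>carrier := ?J1\<rparr> \<cong> additive_monoid\<lparr>carrier := germ_J1\<rparr>"
      using iso_restrict[of germ_J1] by (intro is_isoI[of h]) (simp add: germ_J1_def)
    then show ?thesis using germ_J1_iso by (rule iso_trans)
  qed
  moreover have "MM_bar \<cong> MM //\<^sub>o ?J1"
    using MM_bar_iso(2) MM_quotients(1)[OF h] by (rule iso_trans)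
  ultimately show ?thesis
    using o_ideal_vimage[OF germ_J1_o_ideal] o_ideal_vimage[OF germ_J2_o_ideal]
      MM_subquotient[OF h] MM_quotients(2)[OF h]
    by (intro exI[of _ ?J1] exI[of _ ?J2] conjI)
qed

lemma MM_bar_o_ideal:
  "\<exists>J. o_ideal J MM_bar \<and> MM_bar\<lparr>carrier := J\<rparr> \<cong> Zplus \<times>\<times> Zplus \<and> MM_bar //\<^sub>o J \<cong> Zplus"
proof -
  obtain h where h: "h \<in> iso MM_bar bar_monoid" using MM_bar_iso(2) by (auto simp: is_iso_def)
  interpret comm_monoid_iso MM_bar bar_monoid h
    using h MM_bar_iso(1) comm_monoid_bar by (intro comm_monoid_iso.intro comm_monoid_iso_axioms.intro)
  let ?J = "{x \<in> carrier MM_bar. h x \<in> bar_J2}"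
  have "MM_bar\<lparr>carrier := ?J\<rparr> \<cong> additive_monoid\<lparr>carrier := bar_J2\<rparr>"
    using iso_restrict[of bar_J2] by (intro is_isoI[of h]) simp
  then have "MM_bar\<lparr>carrier := ?J\<rparr> \<cong> Zplus \<times>\<times> Zplus"
    using is_isoI[OF yz_count_iso] by (rule iso_trans)
  then show ?thesis
    using o_ideal_vimage[OF bar_J2_o_ideal] MM_bar_quotient[OF h]
    by (intro exI[of _ ?J] conjI)
qed

theorem theorem4p15:
  shows "(wild TYPE('i) TYPE('b) MM \<and> wild TYPE('i) TYPE('b) MM_bar) \<and>
    (conical MM \<and> stably_finite MM \<and> antisymmetric MM \<and> separative MM \<and> unperforated MM) \<and>
    (conical MM_bar \<and> stably_finite MM_bar \<and> antisymmetric MM_bar \<and> separative MM_bar \<and>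
      unperforated MM_bar) \<and>
    archimedean MM \<and> \<not> archimedean MM_bar \<and>
    (\<exists>J1 J2. o_ideal J1 MM \<and> o_ideal J2 MM \<and> J1 \<subset> J2 \<and>
      MM\<lparr>carrier := J1\<rparr> \<cong> Zplus_sum \<and>
      (MM\<lparr>carrier := J2\<rparr>) //\<^sub>o J1 \<cong> Zplus \<times>\<times> Zplus \<and>
      MM //\<^sub>o J2 \<cong> Zplus \<and>
      MM_bar \<cong> MM //\<^sub>o J1) \<and>
    (\<exists>J2_bar. o_ideal J2_bar MM_bar \<and>
      MM_bar\<lparr>carrier := J2_bar\<rparr> \<cong> Zplus \<times>\<times> Zplus \<and>
      MM_bar //\<^sub>o J2_bar \<cong> Zplus)"
  by (intro conjI MM_wild MM_bar_wild MM_properties MM_bar_properties MM_o_ideals MM_bar_o_ideal)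

end
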